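(* An element $F\in\mathrm{TAut}_2$ belongs to $\mathrm{Sol}(\widehat{KV})$ if and only if $u=\kappa(F)=(A(x,y),B(x,y))$ satisfies $x+y-\mathrm{ch}(y,x)=(1-e^{-\mathrm{ad}_x})A(x,y)+(e^{\mathrm{ad}_y}-1)B(x,y)$ and $\mathrm{div}(u)\in\tilde\delta(\mathfrak{tr}_1)$.
   Context: $k$ is a field of characteristic zero; $\mathfrak{lie}_n$, $\mathrm{Ass}_n$ are the degree completions of the free Lie and free associative algebras over $k$ on $x_1,\dots,x_n$ ($x,y$ for $n=2$); $a=a_0+\sum_k(\partial_ka)x_k$ is the unique decomposition in $\mathrm{Ass}_n$. $\mathfrak{tr}_n=\mathrm{Ass}_n^+/\langle ab-ba\rangle$ with projection $\mathrm{Tr}$; for $f\in xk[[x]]$, $\mathrm{Tr}(f(x))=\sum f_m\mathrm{Tr}(x^m)$. $\mathrm{ch}(x,y)=\ln(e^xe^y)$. $\mathfrak{tder}_2$: derivations $u$ of $\mathfrak{lie}_2$ with $u(x)=[x,a]$, $u(y)=[y,b]$, written $u=(a,b)$ (normalized: $a$ has no term $\lambda x$, $b$ no term $\lambda y$). $\mathrm{div}(u)=\mathrm{Tr}(x\partial_xa+y\partial_yb)$; derivations and automorphisms act on $\mathfrak{tr}_2$. $\tilde\delta:\mathfrak{tr}_1\to\mathfrak{tr}_2$, $\tilde\delta g=g(x)-g(\mathrm{ch}(x,y))+g(y)$. $\mathrm{TAut}_2=\{\exp(u):u\in\mathfrak{tder}_2\}$ (with $\exp(u)=\sum u^m/m!$),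 a group of automorphisms of $\mathfrak{lie}_2$. $j:\mathrm{TAut}_2\to\mathfrak{tr}_2$, $j(\exp u)=\sum_{m\ge0}\frac{u^m}{(m+1)!}\cdot\mathrm{div}(u)$. $\mathrm{Sol}(\widehat{KV})$ is the set of $F\in\mathrm{TAut}_2$ with $F(x+y)=\mathrm{ch}(x,y)$ and $j(F)\in\tilde\delta(\mathfrak{tr}_1)$. Let $l$ be the derivation of $\mathfrak{lie}_2$ with $l(x)=x$, $l(y)=y$; for $F\in\mathrm{TAut}_2$, $\kappa(F)=l-F\circ l\circ F^{-1}\in\mathfrak{tder}_2$. *)

theory Defs
  imports Main
begin

datatype gen = X | Y

text \<open>An element of the completion Ass_2 is a formal noncommutative power series,
  i.e. an arbitrary coefficient function on words in X, Y.\<close>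
type_synonym 'k ser = "gen list \<Rightarrow> 'k"

definition smono :: "gen list \<Rightarrow> 'k::field_char_0 ser" where
  "smono w = (\<lambda>v. if v = w then 1 else 0)"

definition sadd :: "'k::field_char_0 ser \<Rightarrow> 'k ser \<Rightarrow> 'k ser" where
  "sadd f g = (\<lambda>v. f v + g v)"

definition ssub :: "'k::field_char_0 ser \<Rightarrow> 'k ser \<Rightarrow> 'k ser" where
  "ssub f g = (\<lambda>v. f v - g v)"

definition sscale :: "'k::field_char_0 \<Rightarrow> 'k ser \<Rightarrow> 'k ser" where
  "sscale c f = (\<lambda>v. c * f v)"

definition smul :: "'k::field_char_0 ser \<Rightarrow> 'k ser \<Rightarrow> 'k ser" where
  "smul f g = (\<lambda>v. \<Sum>i\<le>length v. f (take i v) * g (drop i v))"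

definition spow :: "'k::field_char_0 ser \<Rightarrow> nat \<Rightarrow> 'k ser" where
  "spow f n = (smul f ^^ n) (smono [])"

definition brk :: "'k::field_char_0 ser \<Rightarrow> 'k ser \<Rightarrow> 'k ser" where
  "brk f g = ssub (smul f g) (smul g f)"

definition hom_part :: "nat \<Rightarrow> 'k::field_char_0 ser \<Rightarrow> 'k ser" where
  "hom_part n f = (\<lambda>v. if length v = n then f v else 0)"

inductive_set lie_poly :: "'k::field_char_0 ser set" where
  gen_X: "smono [X] \<in> lie_poly"
| gen_Y: "smono [Y] \<in> lie_poly"
| add: "f \<in> lie_poly \<Longrightarrow> g \<in> lie_poly \<Longrightarrow> sadd f g \<in> lie_poly"
| scale: "f \<in> lie_poly \<Longrightarrow> sscale c f \<in> lie_poly"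
| bracket: "f \<in> lie_poly \<Longrightarrow> g \<in> lie_poly \<Longrightarrow> brk f g \<in> lie_poly"

definition lie_ser :: "'k::field_char_0 ser set" where
  "lie_ser = {f. \<forall>n. hom_part n f \<in> lie_poly}"

text \<open>u = (a,b) in tder_2, normalized: a has no term \<lambda>x, b no term \<lambda>y.\<close>
definition is_tder :: "'k::field_char_0 ser \<Rightarrow> 'k ser \<Rightarrow> bool" where
  "is_tder a b \<longleftrightarrow> a \<in> lie_ser \<and> b \<in> lie_ser \<and> a [X] = 0 \<and> b [Y] = 0"

definition gen_img :: "'k::field_char_0 ser \<Rightarrow> 'k ser \<Rightarrow> gen \<Rightarrow> 'k ser" where
  "gen_img a b g = (case g of X \<Rightarrow> brk (smono [X]) a | Y \<Rightarrow> brk (smono [Y]) b)"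

definition der_mono :: "'k::field_char_0 ser \<Rightarrow> 'k ser \<Rightarrow> gen list \<Rightarrow> 'k ser" where
  "der_mono a b w = (\<lambda>v. \<Sum>i<length w.
      smul (smul (smono (take i w)) (gen_img a b (w ! i))) (smono (drop (Suc i) w)) v)"

text \<open>The derivation u = (a,b) acting (continuously) on Ass_2; it raises degree by
  at least one since [x,a], [y,b] have degree at least 2, so the sum is finite.\<close>
definition der :: "'k::field_char_0 ser \<Rightarrow> 'k ser \<Rightarrow> 'k ser \<Rightarrow> 'k ser" where
  "der a b f = (\<lambda>v. \<Sum>w\<in>{w. length w < length v}. f w * der_mono a b w v)"

text \<open>Operator power series sum_n c_n T^n f for a degree-raising operator T.\<close>
definition opexp :: "(nat \<Rightarrow> 'k::field_char_0) \<Rightarrow> ('k ser \<Rightarrow> 'k ser) \<Rightarrow> 'k ser \<Rightarrow> 'k ser" where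
  "opexp c T f = (\<lambda>v. \<Sum>n\<le>length v. c n * (T ^^ n) f v)"

text \<open>exp(u) = sum u^m/m!, acting on Ass_2 (restricting to an automorphism of lie_2).\<close>
definition exp_der :: "'k::field_char_0 ser \<Rightarrow> 'k ser \<Rightarrow> 'k ser \<Rightarrow> 'k ser" where
  "exp_der a b = opexp (\<lambda>n. 1 / fact n) (der a b)"

definition sexp :: "'k::field_char_0 ser \<Rightarrow> 'k ser" where
  "sexp f = (\<lambda>v. \<Sum>n\<le>length v. spow f n v / fact n)"

definition slog :: "'k::field_char_0 ser \<Rightarrow> 'k ser" where
  "slog f = (let g = ssub f (smono []) in
     (\<lambda>v. \<Sum>n\<in>{1..length v}. (-1) ^ (n + 1) / of_nat n * spow g n v))"

definition ch :: "'k::field_char_0 ser \<Rightarrow> 'k ser \<Rightarrow> 'k ser" where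
  "ch f g = slog (smul (sexp f) (sexp g))"

text \<open>tr_2 = Ass^+/[Ass,Ass] is identified (degree-wise) with functions on cyclic words:
  Tr f assigns to a nonempty word w the sum of the coefficients of f over the
  distinct cyclic rotations of w.\<close>
definition Tr :: "'k::field_char_0 ser \<Rightarrow> 'k ser" where
  "Tr f = (\<lambda>w. if w = [] then 0 else (\<Sum>v\<in>(\<lambda>n. rotate n w) ` {..<length w}. f v))"

text \<open>x \<partial>_x a + y \<partial>_y b, so div(u) = Tr of it.\<close>
definition div_ser :: "'k::field_char_0 ser \<Rightarrow> 'k ser \<Rightarrow> 'k ser" where
  "div_ser a b = (\<lambda>v. case v of X # w \<Rightarrow> a (w @ [X]) | Y # w \<Rightarrow> b (w @ [Y]) | [] \<Rightarrow> 0)"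

definition divergence :: "'k::field_char_0 ser \<Rightarrow> 'k ser \<Rightarrow> 'k ser" where
  "divergence a b = Tr (div_ser a b)"

text \<open>j(exp u) = sum u^m/(m+1)! . div(u); derivations act on tr_2 by u.Tr(f) = Tr(u f).\<close>
definition j_exp :: "'k::field_char_0 ser \<Rightarrow> 'k ser \<Rightarrow> 'k ser" where
  "j_exp a b = Tr (opexp (\<lambda>n. 1 / fact (Suc n)) (der a b) (div_ser a b))"

text \<open>Substitution of h (no constant term) into g in x k[[x]]: sum_{m>=1} g_m h^m.\<close>
definition psubst :: "(nat \<Rightarrow> 'k::field_char_0) \<Rightarrow> 'k ser \<Rightarrow> 'k ser" where
  "psubst g h = (\<lambda>v. \<Sum>m\<in>{1..length v}. g m * spow h m v)"

text \<open>tilde delta g = g(x) - g(ch(x,y)) + g(y), for g in tr_1 = x k[[x]]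
  (coefficients g m, m >= 1; g 0 is irrelevant).\<close>
definition delta_ser :: "(nat \<Rightarrow> 'k::field_char_0) \<Rightarrow> 'k ser" where
  "delta_ser g = sadd (ssub (psubst g (smono [X])) (psubst g (ch (smono [X]) (smono [Y]))))
                      (psubst g (smono [Y]))"

definition delta_img :: "'k::field_char_0 ser set" where
  "delta_img = {Tr (delta_ser g) | g. True}"

text \<open>F = exp(u) with u = (a,b) in tder_2.\<close>
definition in_Sol :: "'k::field_char_0 ser \<Rightarrow> 'k ser \<Rightarrow> bool" where
  "in_Sol a b \<longleftrightarrow>
     exp_der a b (sadd (smono [X]) (smono [Y])) = ch (smono [X]) (smono [Y])
     \<and> j_exp a b \<in> delta_img"

definition euler :: "'k::field_char_0 ser \<Rightarrow> 'k ser" where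
  "euler f = (\<lambda>v. of_nat (length v) * f v)"

definition kappa :: "'k::field_char_0 ser \<Rightarrow> 'k ser \<Rightarrow> 'k ser \<Rightarrow> 'k ser" where
  "kappa a b f = ssub (euler f) (exp_der a b (euler (inv (exp_der a b) f)))"

end

(* Write D = (a,b), F = exp D, l for the Euler derivation and E = F l F^-1. Each (ad D)^n l with n > 0 is
   a tangential derivation, and so is E - l = sum_{n>0} (ad D)^n l / n!; by uniqueness of normalised
   components, E = l - (A,B).
   Since F is the identity to leading order, F(x+y) is the only series x + y + (degree >= 2) fixed by E,
   so F(x+y) = ch(x,y) iff E ch(x,y) = ch(x,y). As ch(x,y) = log(e^x e^y), this means
   E(e^x e^y) = ch(x,y) e^x e^y; multiplying by e^-x on the left and e^-y on the right turns it into the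
   equation for x + y - ch(y,x).
   The cocycle property of the divergence gives div(A,B) = E j(F). On traces E is injective, and if
   E ch(x,y) = ch(x,y) it maps Tr(x^m), Tr(y^m) and Tr(ch(x,y)^m) to m times themselves; hence it
   preserves and reflects membership in the image of delta-tilde. *)
theory Submission
  imports Defs
begin

section \<open>The algebra of noncommutative power series\<close>

text \<open>All computations take place in the associative algebra. Lie series enter through one
  property: such a series has coefficient zero at every word g^n with n \<noteq> 1. After
  normalisation the component at g then contains no power of g at all. The series commuting with g
  are the series in g, so such a component c can be recovered from [g, c], and the property passes
  from D to each (ad D)^n l with n > 0. The obstacle is that every infinite sum (in
  \<open>der\<close>, in operator exponentials, in exp and log) is cut off at the length of the word
  whose coefficient is read. The cut-off agrees with the true sum when the n-th term has order at
  least n, so order estimates accompany every construction. The identity between div(A,B) and E j(F)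
  is one of traces. It comes from solving a recursion for the divergence of (ad D)^n l. The solution
  contains the binomials C(N+1, m+1), and division by (N+1)! leaves 1/((N-m)! (m+1)!): the first
  factor belongs to exp(ad D) l, the second is the weight in the definition of j.\<close>

typedef 'k nc = "UNIV :: (gen list \<Rightarrow> 'k) set"
  morphisms coeff Nc ..

setup_lifting type_definition_nc

lemma smul_Nil: "smul f g [] = f [] * g []"
  by (simp add: smul_def)

text \<open>Removing the first letter obeys a product rule, as for Brzozowski derivatives of
  languages. This makes convolution recursive on the word, so that associativity becomes an
  induction that generalises over the left factor.\<close>

lemma smul_Cons: "smul f g (x # w) = f [] * g (x # w) + smul (\<lambda>w. f (x # w)) g w"
  by (simp add: smul_def sum.atMost_Suc_shift del: sum.atMost_Suc)

lemma smul_sadd_left: "smul (sadd f g) h = sadd (smul f h) (smul g h)"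
  by (simp add: smul_def sadd_def fun_eq_iff algebra_simps sum.distrib)

lemma smul_sadd_right: "smul h (sadd f g) = sadd (smul h f) (smul h g)"
  by (simp add: smul_def sadd_def fun_eq_iff algebra_simps sum.distrib)

lemma smul_sscale_left: "smul (sscale c f) h = sscale c (smul f h)"
  by (simp add: smul_def sscale_def fun_eq_iff algebra_simps sum_distrib_left)

lemma smul_sscale_right: "smul f (sscale c h) = sscale c (smul f h)"
  by (simp add: smul_def sscale_def fun_eq_iff algebra_simps sum_distrib_left)

lemma smul_assoc: "smul (smul f g) h = smul f (smul g h)"
proof
  fix v show "smul (smul f g) h v = smul f (smul g h) v"
  proof (induction v arbitrary: f)
    case Nil
    then show ?case by (simp add: smul_Nil)
  next
    case (Cons x w)
    have "(\<lambda>w. smul f g (x # w)) = sadd (sscale (f []) (\<lambda>w. g (x # w))) (smul (\<lambda>w. f (x # w)) g)"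
      by (simp add: fun_eq_iff smul_Cons sadd_def sscale_def)
    then have "smul (\<lambda>w. smul f g (x # w)) h w
        = f [] * smul (\<lambda>w. g (x # w)) h w + smul (\<lambda>w. f (x # w)) (smul g h) w"
      by (simp only: smul_sadd_left smul_sscale_left) (simp add: sadd_def sscale_def Cons.IH)
    then show ?case
      by (simp add: smul_Cons smul_Nil algebra_simps)
  qed
qed

lemma smul_one_left: "smul (smono []) g = g"
proof
  fix v show "smul (smono []) g v = g v"
    by (cases v) (simp_all add: smul_Nil smul_Cons smono_def, simp add: smul_def)
qed

lemma smul_one_right: "smul g (smono []) = g"
proof
  fix v show "smul g (smono []) v = g v"
    by (induction v arbitrary: g) (simp_all add: smul_Nil smul_Cons smono_def)
qed

text \<open>A type of its own, unlike the synonym \<open>ser\<close>, can have convolution as its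
  multiplication, which makes powers and \<open>algebra_simps\<close> available.\<close>

instantiation nc :: (field_char_0) ring_1
begin

lift_definition zero_nc :: "'a nc" is "\<lambda>_. 0" .
lift_definition one_nc :: "'a nc" is "smono []" .
lift_definition plus_nc :: "'a nc \<Rightarrow> 'a nc \<Rightarrow> 'a nc" is sadd .
lift_definition minus_nc :: "'a nc \<Rightarrow> 'a nc \<Rightarrow> 'a nc" is ssub .
lift_definition uminus_nc :: "'a nc \<Rightarrow> 'a nc" is "\<lambda>f v. - f v" .
lift_definition times_nc :: "'a nc \<Rightarrow> 'a nc \<Rightarrow> 'a nc" is smul .

instance
proof
  fix f g h :: "'a nc"
  show "f * g * h = f * (g * h)" by transfer (rule smul_assoc)
  show "1 * f = f" by transfer (rule smul_one_left)
  show "f * 1 = f" by transfer (rule smul_one_right)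
  show "(f + g) * h = f * h + g * h" by transfer (rule smul_sadd_left)
  show "h * (f + g) = h * f + h * g" by transfer (rule smul_sadd_right)
  show "(0::'a nc) \<noteq> 1" by transfer (auto simp: smono_def fun_eq_iff)
qed (transfer; simp add: sadd_def ssub_def fun_eq_iff algebra_simps)+

end

lift_definition scl :: "'k::field_char_0 \<Rightarrow> 'k nc \<Rightarrow> 'k nc" is sscale .
lift_definition mono :: "gen list \<Rightarrow> 'k::field_char_0 nc" is smono .

abbreviation gn :: "gen \<Rightarrow> 'k::field_char_0 nc" where "gn g \<equiv> mono [g]"

abbreviation lieb :: "'k::field_char_0 nc \<Rightarrow> 'k nc \<Rightarrow> 'k nc" where
  "lieb f g \<equiv> f * g - g * f"

lemma nc_eqI: "(\<And>v. coeff f v = coeff g v) \<Longrightarrow> f = g"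
  by (metis coeff_inject ext)

lemma coeff_zero [simp]: "coeff 0 v = 0" by transfer simp
lemma coeff_one: "coeff 1 v = (if v = [] then 1 else 0)" by transfer (simp add: smono_def)
lemma coeff_add [simp]: "coeff (f + g) v = coeff f v + coeff g v" by transfer (simp add: sadd_def)
lemma coeff_diff [simp]: "coeff (f - g) v = coeff f v - coeff g v" by transfer (simp add: ssub_def)
lemma coeff_uminus [simp]: "coeff (- f) v = - coeff f v" by transfer simp
lemma coeff_scl [simp]: "coeff (scl r f) v = r * coeff f v" by transfer (simp add: sscale_def)
lemma coeff_mono: "coeff (mono w) v = (if v = w then 1 else 0)" by transfer (simp add: smono_def)
lemma coeff_mult: "coeff (f * g) v = (\<Sum>i\<le>length v. coeff f (take i v) * coeff g (drop i v))"
  by transfer (simp add: smul_def)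
lemma coeff_sum [simp]: "coeff (sum h I) v = (\<Sum>i\<in>I. coeff (h i) v)"
  by (induction I rule: infinite_finite_induct) simp_all
lemma coeff_Nc [simp]: "coeff (Nc f) = f" by (simp add: Nc_inverse)

lemma coeff_mult_Nil [simp]: "coeff (f * g) [] = coeff f [] * coeff g []"
  by (simp add: coeff_mult)

lemma coeff_gn_mult:
  "coeff (gn g * f) (h # w) = (if h = g then coeff f w else 0)"
  "coeff (gn g * f) [] = 0"
proof -
  have "smul (smono [g]) (coeff f) (h # w) = (if h = g then coeff f w else 0)"
    using smul_one_left[of "coeff f"] by (auto simp: smul_Cons smono_def) (auto simp: smul_def)
  then show "coeff (gn g * f) (h # w) = (if h = g then coeff f w else 0)"
    by (simp add: times_nc.rep_eq mono.rep_eq)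
qed (simp add: coeff_mono)

lemma coeff_mult_snoc:
  "coeff (f * k) (w @ [g]) = coeff f (w @ [g]) * coeff k [] + coeff (f * Nc (\<lambda>w. coeff k (w @ [g]))) w"
  by (simp add: coeff_mult)

lemma coeff_mult_gn:
  "coeff (f * gn g) (w @ [h]) = (if h = g then coeff f w else 0)"
  "coeff (f * gn g) [] = 0"
proof -
  have "Nc (\<lambda>w. coeff (gn g) (w @ [h])) = (if h = g then 1 else 0 :: 'a nc)"
    by (rule nc_eqI) (simp add: coeff_mono coeff_one)
  then show "coeff (f * gn g) (w @ [h]) = (if h = g then coeff f w else 0)"
    by (simp add: coeff_mult_snoc coeff_mono)
qed (simp add: coeff_mono)

lemma mono_Nil: "mono [] = 1"
  by (rule nc_eqI) (simp add: coeff_mono coeff_one)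

lemma mono_Cons: "mono (g # w) = gn g * mono w"
proof (rule nc_eqI)
  fix v show "coeff (mono (g # w) :: 'a nc) v = coeff (gn g * mono w) v"
    by (cases v) (auto simp: coeff_gn_mult coeff_mono)
qed

lemma mono_append: "mono (u @ w) = mono u * mono w"
proof (induction u)
  case (Cons g u)
  then show ?case by (simp add: mono_Cons[of g "u @ w"] mono_Cons[of g u] mult.assoc)
qed (simp add: mono_Nil)

lemma scl_simps [simp]:
  "scl r (f + g) = scl r f + scl r g" "scl r (f - g) = scl r f - scl r g"
  "scl r (- f) = - scl r f" "scl r 0 = 0" "scl 0 f = 0" "scl 1 f = f"
  "scl r (scl s f) = scl (r * s) f"
  "scl r f * g = scl r (f * g)" "f * scl r g = scl r (f * g)"
proof -
  show "scl r f * g = scl r (f * g)" by transfer (rule smul_sscale_left)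
  show "f * scl r g = scl r (f * g)" by transfer (rule smul_sscale_right)
qed (rule nc_eqI; simp add: algebra_simps)+

lemma scl_minus_one: "scl (- 1) f = - f"
  by (rule nc_eqI) simp

lemma scl_of_nat: "scl (of_nat n) f = of_nat n * f"
proof -
  have "scl (of_nat n) f = scl (of_nat n) 1 * f" by simp
  also have "scl (of_nat n) (1 :: 'a nc) = of_nat n"
  proof (induction n)
    case (Suc n)
    have "scl (of_nat (Suc n)) (1 :: 'a nc) = 1 + scl (of_nat n) 1"
      by (rule nc_eqI) (simp add: algebra_simps)
    then show ?case by (simp add: Suc.IH)
  qed simp
  finally show ?thesis .
qed

lemma scl_sum: "scl r (sum h I) = (\<Sum>i\<in>I. scl r (h i))"
  by (rule nc_eqI) (simp add: sum_distrib_left)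

lemma UNIV_gen: "(UNIV :: gen set) = {X, Y}"
  using gen.exhaust by auto

instance gen :: finite
  by standard (simp add: UNIV_gen)

lemma finite_words: "finite {w :: gen list. length w \<le> n}" "finite {w :: gen list. length w < n}"
proof -
  show "finite {w :: gen list. length w \<le> n}"
    using finite_lists_length_le[of "UNIV :: gen set" n] by simp
  then show "finite {w :: gen list. length w < n}"
    by (rule rev_finite_subset) auto
qed

section \<open>The degree filtration and the linear maps compatible with it\<close>

definition ord_ge :: "nat \<Rightarrow> 'k::field_char_0 nc \<Rightarrow> bool" where
  "ord_ge n f \<longleftrightarrow> (\<forall>v. length v < n \<longrightarrow> coeff f v = 0)"

lemma ogD: "ord_ge n f \<Longrightarrow> length v < n \<Longrightarrow> coeff f v = 0"
  by (simp add: ord_ge_def)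

lemma ord_ge_zero [simp]: "ord_ge n 0" "ord_ge 0 f" by (simp_all add: ord_ge_def)
lemma ord_ge_add: "ord_ge n f \<Longrightarrow> ord_ge n g \<Longrightarrow> ord_ge n (f + g)" by (simp add: ord_ge_def)
lemma ord_ge_diff: "ord_ge n f \<Longrightarrow> ord_ge n g \<Longrightarrow> ord_ge n (f - g)" by (simp add: ord_ge_def)
lemma ord_ge_uminus: "ord_ge n f \<Longrightarrow> ord_ge n (- f)" by (simp add: ord_ge_def)
lemma ord_ge_scl: "ord_ge n f \<Longrightarrow> ord_ge n (scl r f)" by (simp add: ord_ge_def)
lemma ord_ge_sum: "(\<And>i. i \<in> I \<Longrightarrow> ord_ge n (h i)) \<Longrightarrow> ord_ge n (sum h I)" by (simp add: ord_ge_def)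
lemma ord_ge_le: "ord_ge n f \<Longrightarrow> m \<le> n \<Longrightarrow> ord_ge m f" by (simp add: ord_ge_def)
lemma ord_ge_Suc_0: "ord_ge (Suc 0) f \<longleftrightarrow> coeff f [] = 0" by (simp add: ord_ge_def)
lemma ord_ge_mono: "ord_ge (length w) (mono w)" by (auto simp: ord_ge_def coeff_mono)

lemma ord_ge_mult:
  assumes "ord_ge m f" "ord_ge n g"
  shows "ord_ge (m + n) (f * g)"
  unfolding ord_ge_def coeff_mult
proof (intro allI impI sum.neutral ballI)
  fix v :: "gen list" and i
  assume "length v < m + n" "i \<in> {..length v}"
  then have "length (take i v) < m \<or> length (drop i v) < n" by auto
  then show "coeff f (take i v) * coeff g (drop i v) = 0"
    using ogD[OF assms(1)] ogD[OF assms(2)] by (auto simp del: length_take length_drop)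
qed

lemma ord_ge_mult_left: "ord_ge n f \<Longrightarrow> ord_ge n (g * f)" using ord_ge_mult[of 0 g n f] by simp
lemma ord_ge_mult_right: "ord_ge n f \<Longrightarrow> ord_ge n (f * g)" using ord_ge_mult[of n f 0 g] by simp

lemma ord_ge_power: "ord_ge (Suc 0) f \<Longrightarrow> ord_ge n (f ^ n)"
proof (induction n)
  case (Suc n)
  then show ?case using ord_ge_mult[of "Suc 0" f n "f ^ n"] by simp
qed simp

lemma ord_ge_eq_0: "(\<And>n. ord_ge n f) \<Longrightarrow> f = 0"
  by (rule nc_eqI) (metis coeff_zero lessI ord_ge_def)

text \<open>Compatibility with the filtration plays the part of continuity: a coefficient of
  \<open>T f\<close> depends on finitely many coefficients of \<open>f\<close>. Hence such a map is
  determined by its values on words and may be applied to a \<open>ser_sum\<close> term by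
  term.\<close>

definition filt_lin :: "('k::field_char_0 nc \<Rightarrow> 'k nc) \<Rightarrow> bool" where
  "filt_lin T \<longleftrightarrow> (\<forall>f g. T (f + g) = T f + T g) \<and> (\<forall>r f. T (scl r f) = scl r (T f)) \<and>
    (\<forall>n f. ord_ge n f \<longrightarrow> ord_ge n (T f))"

lemma filt_lin_add: "filt_lin T \<Longrightarrow> T (f + g) = T f + T g" by (simp add: filt_lin_def)
lemma filt_lin_scl: "filt_lin T \<Longrightarrow> T (scl r f) = scl r (T f)" by (simp add: filt_lin_def)
lemma filt_lin_ord_ge: "filt_lin T \<Longrightarrow> ord_ge n f \<Longrightarrow> ord_ge n (T f)" by (simp add: filt_lin_def)
lemma filt_lin_zero: "filt_lin T \<Longrightarrow> T 0 = 0" using filt_lin_scl[of T 0 0] by simp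
lemma filt_lin_uminus: "filt_lin T \<Longrightarrow> T (- f) = - T f" by (metis filt_lin_scl scl_minus_one)
lemma filt_lin_diff: "filt_lin T \<Longrightarrow> T (f - g) = T f - T g"
  by (metis filt_lin_add filt_lin_uminus diff_conv_add_uminus)
lemma filt_lin_sum: "filt_lin T \<Longrightarrow> T (sum h I) = (\<Sum>i\<in>I. T (h i))"
  by (induction I rule: infinite_finite_induct) (simp_all add: filt_lin_zero filt_lin_add)

lemma filt_lin_compose: "filt_lin T \<Longrightarrow> filt_lin U \<Longrightarrow> filt_lin (\<lambda>f. T (U f))" by (simp add: filt_lin_def)
lemma filt_lin_plus: "filt_lin T \<Longrightarrow> filt_lin U \<Longrightarrow> filt_lin (\<lambda>f. T f + U f)" by (simp add: filt_lin_def ord_ge_add)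
lemma filt_lin_minus: "filt_lin T \<Longrightarrow> filt_lin U \<Longrightarrow> filt_lin (\<lambda>f. T f - U f)" by (simp add: filt_lin_def ord_ge_diff)
lemma filt_lin_neg: "filt_lin T \<Longrightarrow> filt_lin (\<lambda>f. - T f)" by (simp add: filt_lin_def ord_ge_uminus)
lemma filt_lin_mult_left: "filt_lin (\<lambda>f. g * f)" by (simp add: filt_lin_def ord_ge_mult_left distrib_left)
lemma filt_lin_mult_right: "filt_lin (\<lambda>f. f * g)" by (simp add: filt_lin_def ord_ge_mult_right distrib_right)
lemma filt_lin_scl_fun: "filt_lin T \<Longrightarrow> filt_lin (\<lambda>f. scl r (T f))"
  by (simp add: filt_lin_def ord_ge_scl mult.commute)
lemma filt_lin_funpow: "filt_lin T \<Longrightarrow> filt_lin (T ^^ n)"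
  by (induction n) (simp_all add: filt_lin_def)

definition trunc :: "nat \<Rightarrow> 'k::field_char_0 nc \<Rightarrow> 'k nc" where
  "trunc n f = (\<Sum>w | length w < n. scl (coeff f w) (mono w))"

lemma coeff_trunc: "coeff (trunc n f) v = (if length v < n then coeff f v else 0)"
proof -
  have "coeff (trunc n f) v = (\<Sum>w | length w < n. if v = w then coeff f w else 0)"
    unfolding trunc_def coeff_sum by (rule sum.cong) (simp_all add: coeff_mono)
  then show ?thesis by (simp add: sum.delta finite_words)
qed

lemma ord_ge_diff_trunc: "ord_ge n (f - trunc n f)"
  by (simp add: ord_ge_def coeff_trunc)

lemma filt_lin_coeff:
  assumes "filt_lin T" "length v < n"
  shows "coeff (T f) v = (\<Sum>w | length w < n. coeff f w * coeff (T (mono w)) v)"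
proof -
  have "coeff (T (f - trunc n f)) v = 0"
    using filt_lin_ord_ge[OF assms(1) ord_ge_diff_trunc] assms(2) by (rule ogD)
  then have "coeff (T f) v = coeff (T (trunc n f)) v"
    by (simp add: filt_lin_diff[OF assms(1)])
  then show ?thesis
    by (simp add: trunc_def filt_lin_sum[OF assms(1)] filt_lin_scl[OF assms(1)])
qed

lemma filt_lin_eqI:
  assumes "filt_lin T" "filt_lin U" "\<And>w. T (mono w) = U (mono w)"
  shows "T f = U f"
proof (rule nc_eqI)
  fix v
  show "coeff (T f) v = coeff (U f) v"
    unfolding filt_lin_coeff[OF assms(1) lessI, of f v] filt_lin_coeff[OF assms(2) lessI, of f v] assms(3) ..
qed

text \<open>The cut-off at the length of the word makes this a total function. It is the sum in the
  completed algebra as soon as \<open>ser_summable\<close> holds, because then later terms cannot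
  contribute to that word.\<close>

definition ser_sum :: "(nat \<Rightarrow> 'k::field_char_0 nc) \<Rightarrow> 'k nc" where
  "ser_sum h = Nc (\<lambda>v. \<Sum>n\<le>length v. coeff (h n) v)"

definition ser_summable :: "(nat \<Rightarrow> 'k::field_char_0 nc) \<Rightarrow> bool" where
  "ser_summable h \<longleftrightarrow> (\<forall>n. ord_ge n (h n))"

lemma coeff_ser_sum: "coeff (ser_sum h) v = (\<Sum>n\<le>length v. coeff (h n) v)"
  by (simp add: ser_sum_def)

lemma coeff_ser_sum_ge:
  assumes "ser_summable h" "length v \<le> N"
  shows "coeff (ser_sum h) v = coeff (\<Sum>n\<le>N. h n) v"
proof -
  have "coeff (ser_sum h) v = (\<Sum>n\<le>length v. coeff (h n) v)" by (rule coeff_ser_sum)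
  also have "\<dots> = (\<Sum>n\<le>N. coeff (h n) v)"
    using assms by (intro sum.mono_neutral_left) (auto simp: ser_summable_def ord_ge_def)
  finally show ?thesis by simp
qed

lemma filt_lin_ser_sum:
  assumes T: "filt_lin T" and h: "ser_summable h"
  shows "T (ser_sum h) = ser_sum (\<lambda>n. T (h n))"
proof (rule nc_eqI)
  fix v :: "gen list"
  let ?s = "\<Sum>n\<le>length v. h n"
  have "ord_ge (Suc (length v)) (ser_sum h - ?s)"
    unfolding ord_ge_def
  proof (intro allI impI)
    fix w :: "gen list" assume "length w < Suc (length v)"
    then have "coeff (ser_sum h) w = coeff ?s w" by (intro coeff_ser_sum_ge h) simp
    then show "coeff (ser_sum h - ?s) w = 0" by simp
  qed
  then have "coeff (T (ser_sum h - ?s)) v = 0"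
    using filt_lin_ord_ge[OF T] ogD by blast
  then have "coeff (T (ser_sum h)) v = coeff (T ?s) v" by (simp add: filt_lin_diff[OF T])
  then show "coeff (T (ser_sum h)) v = coeff (ser_sum (\<lambda>n. T (h n))) v"
    by (simp add: filt_lin_sum[OF T] coeff_ser_sum)
qed

lemma ser_sum_add: "ser_sum (\<lambda>n. f n + g n) = ser_sum f + ser_sum g"
  by (rule nc_eqI) (simp add: coeff_ser_sum sum.distrib)

lemma ser_sum_diff: "ser_sum (\<lambda>n. f n - g n) = ser_sum f - ser_sum g"
  by (rule nc_eqI) (simp add: coeff_ser_sum sum_subtractf)

lemma ser_sum_uminus: "ser_sum (\<lambda>n. - f n) = - ser_sum f"
  by (rule nc_eqI) (simp add: coeff_ser_sum sum_negf)

lemma ser_sum_scl: "ser_sum (\<lambda>n. scl r (f n)) = scl r (ser_sum f)"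
  by (rule nc_eqI) (simp add: coeff_ser_sum sum_distrib_left)

lemma ord_ge_ser_sum: "(\<And>n. ord_ge m (h n)) \<Longrightarrow> ord_ge m (ser_sum h)"
  by (simp add: ord_ge_def coeff_ser_sum)

lemma ser_sum_single: "ser_sum (\<lambda>n. if n = 0 then f else 0) = f"
proof (rule nc_eqI)
  fix v
  have "coeff (ser_sum (\<lambda>n. if n = 0 then f else 0)) v = (\<Sum>n\<le>length v. if n = 0 then coeff f v else 0)"
    unfolding coeff_ser_sum by (rule sum.cong) simp_all
  then show "coeff (ser_sum (\<lambda>n. if n = 0 then f else 0)) v = coeff f v" by simp
qed

text \<open>Reindexing moves the cut-off by one. The additional term
  \<open>h (Suc (length v))\<close> vanishes at \<open>v\<close> by its order.\<close>

lemma ser_sum_shift: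
  assumes "h 0 = 0" "\<And>n. ord_ge (Suc n) (h (Suc n))"
  shows "ser_sum h = ser_sum (\<lambda>n. h (Suc n))"
proof (rule nc_eqI)
  fix v
  have "coeff (ser_sum h) v = (\<Sum>n<length v. coeff (h (Suc n)) v)"
    using assms(1) by (cases "length v")
      (simp_all add: coeff_ser_sum sum.atMost_Suc_shift lessThan_Suc_atMost del: sum.atMost_Suc)
  also have "\<dots> = (\<Sum>n\<le>length v. coeff (h (Suc n)) v)"
    using assms(2) by (intro sum.mono_neutral_left) (auto simp: ord_ge_def)
  finally show "coeff (ser_sum h) v = coeff (ser_sum (\<lambda>n. h (Suc n))) v" by (simp add: coeff_ser_sum)
qed

text \<open>The two cut-offs leave a square of index pairs; the order hypothesis kills everything
  outside the triangle i + j \<le> \<open>length v\<close>, which is then summed along its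
  diagonals.\<close>

lemma ser_sum_ser_sum:
  assumes "\<And>n m. ord_ge (n + m) (h n m)"
  shows "ser_sum (\<lambda>n. ser_sum (h n)) = ser_sum (\<lambda>N. \<Sum>n\<le>N. h n (N - n))"
proof (rule nc_eqI)
  fix v :: "gen list"
  let ?N = "length v"
  have "coeff (ser_sum (\<lambda>n. ser_sum (h n))) v = (\<Sum>(i, j) \<in> {..?N} \<times> {..?N}. coeff (h i j) v)"
    by (simp add: coeff_ser_sum sum.cartesian_product)
  also have "\<dots> = (\<Sum>(i, j) \<in> {(i, j). i + j \<le> ?N}. coeff (h i j) v)"
    by (intro sum.mono_neutral_right) (auto intro!: ogD[OF assms])
  also have "\<dots> = (\<Sum>k\<le>?N. \<Sum>i\<le>k. coeff (h i (k - i)) v)"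
    by (rule sum.triangle_reindex_eq)
  finally show "coeff (ser_sum (\<lambda>n. ser_sum (h n))) v = coeff (ser_sum (\<lambda>N. \<Sum>n\<le>N. h n (N - n))) v"
    by (simp add: coeff_ser_sum)
qed

section \<open>Exponentials of degree-raising operators\<close>

definition expo :: "('k::field_char_0 nc \<Rightarrow> 'k nc) \<Rightarrow> 'k nc \<Rightarrow> 'k nc" where
  "expo T f = ser_sum (\<lambda>n. scl (1 / fact n) ((T ^^ n) f))"

definition raises :: "nat \<Rightarrow> ('k::field_char_0 nc \<Rightarrow> 'k nc) \<Rightarrow> bool" where
  "raises k T \<longleftrightarrow> (\<forall>n f. ord_ge n f \<longrightarrow> ord_ge (k + n) (T f))"

lemma raisesD: "raises k T \<Longrightarrow> ord_ge n f \<Longrightarrow> ord_ge (k + n) (T f)" by (simp add: raises_def)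

lemma raises_1D: "raises 1 T \<Longrightarrow> ord_ge n f \<Longrightarrow> ord_ge (Suc n) (T f)" using raisesD[of 1] by simp

lemma raises_funpow: "raises 1 T \<Longrightarrow> raises n (T ^^ n)"
  by (induction n) (auto simp: raises_def)

lemma ord_ge_funpow: "raises 1 T \<Longrightarrow> ord_ge n ((T ^^ n) f)"
  using raisesD[OF raises_funpow, of T 0 f n] by simp

lemma ser_summable_expo: "raises 1 T \<Longrightarrow> ser_summable (\<lambda>n. scl (c n) ((T ^^ n) f))"
  by (simp add: ser_summable_def ord_ge_scl ord_ge_funpow)

lemma filt_lin_ser_sum_fun:
  assumes "\<And>n. filt_lin (T n)"
  shows "filt_lin (\<lambda>f. ser_sum (\<lambda>n. T n f))"
  using assms by (simp add: filt_lin_def ord_ge_ser_sum ser_sum_add ser_sum_scl)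

text \<open>The binomial theorem in the form needed both for commuting operators and for iterated
  commutators: only the action of \<open>D\<close> on the array \<open>h\<close> matters.\<close>
lemma funpow_binomial:
  assumes "filt_lin D" and "\<And>i j. D (h i j) = h (Suc i) j + h i (Suc j)"
  shows "(D ^^ n) (h 0 0) = (\<Sum>i\<le>n. scl (of_nat (n choose i)) (h i (n - i)))"
proof (induction n)
  case 0
  then show ?case by simp
next
  case (Suc n)
  let ?a = "\<lambda>i. scl (of_nat (n choose i)) (h i (Suc n - i))"
  have "(D ^^ Suc n) (h 0 0) = (\<Sum>i\<le>n. scl (of_nat (n choose i)) (D (h i (n - i))))"
    by (simp add: Suc.IH filt_lin_sum[OF assms(1)] filt_lin_scl[OF assms(1)])
  also have "\<dots> = (\<Sum>i\<le>n. scl (of_nat (n choose i)) (h (Suc i) (n - i)) + ?a i)"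
    by (rule sum.cong) (simp_all add: assms(2) Suc_diff_le)
  also have "\<dots> = (\<Sum>i\<le>n. scl (of_nat (n choose i)) (h (Suc i) (n - i))) + (\<Sum>i\<le>n. ?a i)"
    by (rule sum.distrib)
  also have "(\<Sum>i\<le>n. ?a i) = (\<Sum>i\<le>Suc n. ?a i)" by (simp add: binomial_eq_0)
  also have "\<dots> = ?a 0 + (\<Sum>i\<le>n. ?a (Suc i))"
    by (rule sum.atMost_Suc_shift)
  also have "(\<Sum>i\<le>n. scl (of_nat (n choose i)) (h (Suc i) (n - i))) + (?a 0 + (\<Sum>i\<le>n. ?a (Suc i)))
     = ?a 0 + (\<Sum>i\<le>n. scl (of_nat (Suc n choose Suc i)) (h (Suc i) (n - i)))"
  proof -
    have "scl (of_nat (Suc n choose Suc i)) f = scl (of_nat (n choose i)) f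
        + scl (of_nat (n choose Suc i)) f" for i and f :: "'a nc"
      by (rule nc_eqI) (simp add: algebra_simps)
    then show ?thesis by (simp add: sum.distrib algebra_simps)
  qed
  also have "\<dots> = (\<Sum>i\<le>Suc n. scl (of_nat (Suc n choose i)) (h i (Suc n - i)))"
    by (simp add: sum.atMost_Suc_shift del: sum.atMost_Suc)
  finally show ?case .
qed

lemma expo_binomial:
  assumes "filt_lin D" and "\<And>i j. D (h i j) = h (Suc i) j + h i (Suc j)" and "\<And>i j. ord_ge (i + j) (h i j)"
  shows "expo D (h 0 0) = ser_sum (\<lambda>i. ser_sum (\<lambda>j. scl (1 / (fact i * fact j)) (h i j)))"
proof -
  have "scl (1 / fact n) ((D ^^ n) (h 0 0)) = (\<Sum>i\<le>n. scl (1 / (fact i * fact (n - i))) (h i (n - i)))" for n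
    unfolding funpow_binomial[of D h, OF assms(1,2)] scl_sum
    by (rule sum.cong) (simp_all add: binomial_fact field_simps)
  then show ?thesis
    unfolding expo_def by (subst ser_sum_ser_sum) (simp_all add: ord_ge_scl assms(3))
qed

text \<open>With \<open>U\<close> the negative of \<open>T\<close> this inverts exponentials; with a
  left and a right multiplication it turns exp(ad f) into conjugation by exp f.\<close>

lemma expo_add:
  assumes T: "filt_lin T" "raises 1 T" and U: "filt_lin U" "raises 1 U" and comm: "\<And>f. T (U f) = U (T f)"
  shows "expo (\<lambda>f. T f + U f) f = expo T (expo U f)"
proof -
  have c: "U ((T ^^ i) f) = (T ^^ i) (U f)" for i f
    by (induction i) (simp_all flip: comm)
  have "expo (\<lambda>f. T f + U f) ((T ^^ 0) ((U ^^ 0) f))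
    = ser_sum (\<lambda>i. ser_sum (\<lambda>j. scl (1 / (fact i * fact j)) ((T ^^ i) ((U ^^ j) f))))"
    by (rule expo_binomial)
      (simp_all add: filt_lin_plus T U c raisesD[OF raises_funpow[OF T(2)]] ord_ge_funpow[OF U(2)])
  also have "\<dots> = expo T (expo U f)"
    unfolding expo_def
    by (simp add: filt_lin_ser_sum[OF filt_lin_funpow[OF T(1)] ser_summable_expo[OF U(2)]] filt_lin_scl[OF filt_lin_funpow[OF T(1)]]
        flip: ser_sum_scl)
  finally show ?thesis by simp
qed

lemma expo_zero: "expo (\<lambda>f. 0) f = f"
proof -
  have "scl (1 / fact n) (((\<lambda>f. 0) ^^ n) f) = (if n = 0 then f else 0)" for n
    by (cases n) simp_all
  then show ?thesis by (simp add: expo_def ser_sum_single)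
qed

section \<open>Derivations and traces\<close>

definition derivation :: "('k::field_char_0 nc \<Rightarrow> 'k nc) \<Rightarrow> bool" where
  "derivation T \<longleftrightarrow> filt_lin T \<and> (\<forall>f g. T (f * g) = T f * g + f * T g)"

lemma derivation_filt_lin: "derivation T \<Longrightarrow> filt_lin T" by (simp add: derivation_def)

lemma derivation_mult: "derivation T \<Longrightarrow> T (f * g) = T f * g + f * T g"
  by (simp add: derivation_def)

lemma derivation_one:
  assumes "derivation T"
  shows "T 1 = 0"
  using derivation_mult[OF assms, of 1 1] by simp

lemma derivation_eqI:
  assumes T: "derivation T" and U: "derivation U" and gn: "\<And>g. T (gn g) = U (gn g)"
  shows "T f = U f"
proof (rule filt_lin_eqI[OF derivation_filt_lin[OF T] derivation_filt_lin[OF U]])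
  fix w show "T (mono w) = U (mono w)"
  proof (induction w)
    case Nil
    then show ?case by (simp add: mono_Nil derivation_one T U)
  next
    case (Cons g w)
    then show ?case
      unfolding mono_Cons[of g w] derivation_mult[OF T] derivation_mult[OF U] gn by simp
  qed
qed

lemma derivation_plus: "derivation T \<Longrightarrow> derivation U \<Longrightarrow> derivation (\<lambda>f. T f + U f)"
  by (simp add: derivation_def filt_lin_plus algebra_simps)

lemma derivation_minus: "derivation T \<Longrightarrow> derivation U \<Longrightarrow> derivation (\<lambda>f. T f - U f)"
  by (simp add: derivation_def filt_lin_minus algebra_simps)

lemma derivation_neg: "derivation T \<Longrightarrow> derivation (\<lambda>f. - T f)"
  by (simp add: derivation_def filt_lin_neg algebra_simps)

lemma derivation_commutator:
  assumes T: "derivation T" and U: "derivation U"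
  shows "derivation (\<lambda>f. T (U f) - U (T f))"
proof -
  note filt_lin = derivation_filt_lin[OF T] derivation_filt_lin[OF U]
  show ?thesis
    unfolding derivation_def
    by (intro conjI filt_lin_minus filt_lin_compose[OF filt_lin] filt_lin_compose[OF filt_lin(2,1)])
      (simp add: derivation_mult[OF T] derivation_mult[OF U] filt_lin_add[OF filt_lin(1)] filt_lin_add[OF filt_lin(2)]
        algebra_simps)
qed

lemma derivation_commuting_power:
  assumes T: "derivation T" and "f * T f = T f * f"
  shows "T (f ^ n) = scl (of_nat n) (f ^ (n - 1) * T f)"
proof (induction n)
  case 0
  then show ?case by (simp add: derivation_one[OF T])
next
  case (Suc n)
  have c: "T f * f ^ n = f ^ n * T f"
    by (rule power_commuting_commutes[OF assms(2), symmetric])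
  have "T (f ^ Suc n) = f ^ n * T f + scl (of_nat n) (f * f ^ (n - 1) * T f)"
    by (simp add: derivation_mult[OF T] Suc.IH c mult.assoc)
  also have "\<dots> = f ^ n * T f + scl (of_nat n) (f ^ n * T f)"
    by (cases n) simp_all
  also have "\<dots> = scl (of_nat (Suc n)) (f ^ n * T f)"
    by (rule nc_eqI) (simp add: algebra_simps)
  finally show ?case by simp
qed

text \<open>Indexing the two components by the generator lets x and y be treated by one argument,
  with sums over \<open>UNIV\<close> in place of explicit pairs.\<close>

definition tder :: "(gen \<Rightarrow> 'k::field_char_0 nc) \<Rightarrow> 'k nc \<Rightarrow> 'k nc" where
  "tder c f = Nc (der (coeff (c X)) (coeff (c Y)) (coeff f))"

definition tder_mono :: "(gen \<Rightarrow> 'k::field_char_0 nc) \<Rightarrow> gen list \<Rightarrow> 'k nc" where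
  "tder_mono c w = (\<Sum>i<length w. mono (take i w) * lieb (gn (w ! i)) (c (w ! i)) * mono (drop (Suc i) w))"

lemma coeff_tder_mono: "coeff (tder_mono c w) = der_mono (coeff (c X)) (coeff (c Y)) w"
proof -
  have "gen_img (coeff (c X)) (coeff (c Y)) g = coeff (lieb (gn g) (c g))" for g
    by (cases g) (simp_all add: gen_img_def brk_def minus_nc.rep_eq times_nc.rep_eq mono.rep_eq)
  then show ?thesis
    by (intro ext) (simp only: tder_mono_def der_mono_def coeff_sum times_nc.rep_eq mono.rep_eq)
qed

lemma coeff_tder: "coeff (tder c f) v = (\<Sum>w | length w < length v. coeff f w * coeff (tder_mono c w) v)"
  by (simp add: tder_def der_def coeff_tder_mono)

lemma tder_mono_Cons: "tder_mono c (g # w) = lieb (gn g) (c g) * mono w + gn g * tder_mono c w"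
proof -
  have "tder_mono c (g # w) = lieb (gn g) (c g) * mono w +
    (\<Sum>i<length w. mono (g # take i w) * lieb (gn (w ! i)) (c (w ! i)) * mono (drop (Suc i) w))"
    unfolding tder_mono_def list.size add_Suc_right add_0_right sum.lessThan_Suc_shift by (simp add: mono_Nil)
  also have "(\<Sum>i<length w. mono (g # take i w) * lieb (gn (w ! i)) (c (w ! i)) * mono (drop (Suc i) w))
      = gn g * tder_mono c w"
    unfolding tder_mono_def sum_distrib_left
  proof (rule sum.cong)
    fix i
    show "mono (g # take i w) * lieb (gn (w ! i)) (c (w ! i)) * mono (drop (Suc i) w)
      = gn g * (mono (take i w) * lieb (gn (w ! i)) (c (w ! i)) * mono (drop (Suc i) w))"
      unfolding mono_Cons[of g "take i w"] by (simp add: mult.assoc)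
  qed simp
  finally show ?thesis .
qed

lemma filt_lin_tder: "filt_lin (tder c)"
  by (auto simp: filt_lin_def ord_ge_def coeff_tder sum_distrib_left algebra_simps sum.distrib intro!: nc_eqI sum.neutral)

text \<open>The coefficient of \<open>tder c f\<close> at a word only involves strictly shorter
  words, so the cut-off in \<open>der\<close> by itself raises the degree.\<close>

lemma raises_tder: "raises 1 (tder c)"
  by (auto simp: raises_def ord_ge_def coeff_tder intro!: sum.neutral)

lemma ord_ge_gn: "ord_ge (Suc 0) (gn g)" using ord_ge_mono[of "[g]"] by simp

lemma ord_ge_lieb_gn: "ord_ge (Suc 0) f \<Longrightarrow> ord_ge 2 (lieb (gn g) f)"
  using ord_ge_mult[of "Suc 0" "gn g" "Suc 0" f] ord_ge_mult[of "Suc 0" f "Suc 0" "gn g"]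
  by (simp add: ord_ge_gn ord_ge_diff numeral_2_eq_2)

text \<open>The order hypothesis makes the truncation of the sum in \<^const>\<open>der\<close> harmless.\<close>
lemma tder_of_mono:
  assumes "\<And>g. ord_ge (Suc 0) (c g)"
  shows "tder c (mono w) = tder_mono c w"
proof (rule nc_eqI)
  fix v
  have ord_ge: "ord_ge (Suc (length w)) (tder_mono c w)"
  proof (induction w)
    case (Cons g w)
    have "ord_ge (2 + length w) (lieb (gn g) (c g) * mono w)"
      by (intro ord_ge_mult ord_ge_lieb_gn assms ord_ge_mono)
    moreover have "ord_ge (Suc 0 + Suc (length w)) (gn g * tder_mono c w)"
      by (intro ord_ge_mult ord_ge_gn Cons.IH)
    ultimately show ?case by (simp add: tder_mono_Cons ord_ge_add)
  qed (simp add: tder_mono_def)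
  have "coeff (tder c (mono w)) v = (\<Sum>u | length u < length v. if w = u then coeff (tder_mono c u) v else 0)"
    unfolding coeff_tder by (rule sum.cong) (simp_all add: coeff_mono)
  also have "\<dots> = (if length w < length v then coeff (tder_mono c w) v else 0)"
    by (simp add: sum.delta finite_words)
  finally show "coeff (tder c (mono w)) v = coeff (tder_mono c w) v"
    using ogD[OF ord_ge, of v] by auto
qed

lemma derivation_tder:
  assumes c: "\<And>g. ord_ge (Suc 0) (c g)"
  shows "derivation (tder c)"
proof -
  have m: "tder c (mono u * mono w) = tder c (mono u) * mono w + mono u * tder c (mono w)" for u w
  proof (induction u)
    case Nil
    have "tder c 1 = 0" using tder_of_mono[OF c, where w = "[]"] by (simp add: tder_mono_def mono_Nil)
    then show ?case by (simp add: mono_Nil)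
  next
    case (Cons g u)
    have "tder c (mono (g # u) * mono w) = tder_mono c (g # u @ w)"
      by (simp add: tder_of_mono[OF c] flip: mono_append)
    also have "\<dots> = lieb (gn g) (c g) * (mono u * mono w) + gn g * tder c (mono u * mono w)"
      by (simp add: tder_mono_Cons tder_of_mono[OF c] flip: mono_append)
    also have "\<dots> = tder_mono c (g # u) * mono w + (gn g * mono u) * tder_mono c w"
      unfolding Cons.IH by (simp add: tder_mono_Cons tder_of_mono[OF c] algebra_simps)
    also have "gn g * mono u = mono (g # u)" by (rule mono_Cons[symmetric])
    finally show ?case by (simp add: tder_of_mono[OF c])
  qed
  \<comment> \<open>The Leibniz rule is known for two words. Both sides are filtered linear in each
    factor, so it extends to series one factor at a time.\<close>
  have m': "tder c (f * mono w) = tder c f * mono w + f * tder c (mono w)" for f w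
    by (rule filt_lin_eqI[where f = f, OF filt_lin_compose[OF filt_lin_tder filt_lin_mult_right]
          filt_lin_plus[OF filt_lin_compose[OF filt_lin_mult_right filt_lin_tder] filt_lin_mult_right] m])
  have "tder c (f * h) = tder c f * h + f * tder c h" for f h
    by (rule filt_lin_eqI[where f = h, OF filt_lin_compose[OF filt_lin_tder filt_lin_mult_left]
          filt_lin_plus[OF filt_lin_mult_left filt_lin_compose[OF filt_lin_mult_left filt_lin_tder]] m'])
  then show ?thesis by (simp add: derivation_def filt_lin_tder)
qed

lemma tder_gn:
  assumes "\<And>g. ord_ge (Suc 0) (c g)"
  shows "tder c (gn g) = lieb (gn g) (c g)"
  by (simp add: tder_of_mono[of c, OF assms] tder_mono_Cons mono_Nil) (simp add: tder_mono_def)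

definition euler_op :: "'k::field_char_0 nc \<Rightarrow> 'k nc" where
  "euler_op f = Nc (euler (coeff f))"

lemma coeff_euler_op: "coeff (euler_op f) v = of_nat (length v) * coeff f v"
  by (simp add: euler_op_def euler_def)

lemma derivation_euler_op: "derivation euler_op"
proof -
  have "euler_op (f * g) = euler_op f * g + f * euler_op g" for f g :: "'a nc"
  proof (rule nc_eqI)
    fix v
    have "coeff (euler_op f * g + f * euler_op g) v = (\<Sum>i\<le>length v. of_nat (i + (length v - i)) *
        (coeff f (take i v) * coeff g (drop i v)))"
      unfolding coeff_add coeff_mult sum.distrib[symmetric]
      by (rule sum.cong) (simp_all add: coeff_euler_op min_def algebra_simps)
    also have "\<dots> = coeff (euler_op (f * g)) v"
      unfolding coeff_euler_op coeff_mult sum_distrib_left by (rule sum.cong) simp_all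
    finally show "coeff (euler_op (f * g)) v = coeff (euler_op f * g + f * euler_op g) v" ..
  qed
  moreover have "filt_lin (euler_op :: 'a nc \<Rightarrow> 'a nc)"
    by (auto simp: filt_lin_def ord_ge_def coeff_euler_op algebra_simps intro!: nc_eqI)
  ultimately show ?thesis by (simp add: derivation_def)
qed

lemma euler_op_gn: "euler_op (gn g) = gn g"
  by (rule nc_eqI) (simp add: coeff_euler_op coeff_mono)

text \<open>A series commuting with g is a series in g. Indeed, commutation identifies the
  coefficient at a word ending in g with the coefficient after moving this g to the front. If the
  word contains another letter, repetition brings such a letter to the end, where
  \<open>f * gn g\<close> has coefficient 0.\<close>

lemma lieb_gn_eq_0:
  assumes comm: "lieb (gn g) f = 0" and pow: "\<And>n. coeff f (replicate n g) = 0"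
  shows "f = 0"
proof -
  have shift: "coeff f w = coeff (f * gn g) (g # w)" for w
    using comm by (metis coeff_gn_mult(1) eq_iff_diff_eq_0)
  have last: "coeff f (u @ [h] @ replicate k g) = 0" if "h \<noteq> g" for u h k
  proof (induction k arbitrary: u)
    case 0
    show ?case using shift[of "u @ [h]"] coeff_mult_gn(1)[of f g "g # u" h] that by simp
  next
    case (Suc k)
    have "coeff f (u @ [h] @ replicate (Suc k) g) = coeff (f * gn g) ((g # u @ [h] @ replicate k g) @ [g])"
      by (subst shift) (simp add: replicate_append_same)
    also have "\<dots> = coeff f ((g # u) @ [h] @ replicate k g)"
      by (subst coeff_mult_gn) simp
    finally show ?case using Suc.IH[of "g # u"] by simp
  qed
  have cases: "(\<exists>n. w = replicate n g) \<or> (\<exists>u h k. h \<noteq> g \<and> w = u @ [h] @ replicate k g)" for w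
  proof (induction w rule: rev_induct)
    case (snoc h w)
    show ?case
    proof (cases "h = g")
      case True
      with snoc.IH show ?thesis
        by (metis append_assoc replicate_Suc replicate_append_same)
    next
      case False
      then have "w @ [h] = w @ [h] @ replicate 0 g" by simp
      with False show ?thesis by blast
    qed
  qed simp
  show ?thesis
  proof (rule nc_eqI)
    fix w
    show "coeff f w = coeff 0 w"
      using cases[of w] pow last by (elim disjE exE conjE) simp_all
  qed
qed

text \<open>This is the kernel of the ring homomorphism onto k[[g]] that sends the other generator
  to 0. It is therefore an ideal that contains all commutators.\<close>

definition no_powers :: "gen \<Rightarrow> 'k::field_char_0 nc \<Rightarrow> bool" where
  "no_powers g f \<longleftrightarrow> (\<forall>n. coeff f (replicate n g) = 0)"

lemma no_powersD: "no_powers g f \<Longrightarrow> coeff f (replicate n g) = 0"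
  by (simp add: no_powers_def)

lemma no_powers_ord_ge: "no_powers g f \<Longrightarrow> ord_ge (Suc 0) f"
  using no_powersD[of g f 0] by (simp add: ord_ge_Suc_0)

lemma coeff_mult_replicate:
  "coeff (f * h) (replicate n g) = (\<Sum>i\<le>n. coeff f (replicate i g) * coeff h (replicate (n - i) g))"
  unfolding coeff_mult by (rule sum.cong) (auto simp: min_def)

lemma no_powers_lieb: "no_powers g (lieb f h)"
proof -
  have "(\<Sum>i\<le>n. coeff f (replicate i g) * coeff h (replicate (n - i) g))
     = (\<Sum>i\<le>n. coeff h (replicate i g) * coeff f (replicate (n - i) g))" for n
    by (rule sum.reindex_bij_witness[of _ "\<lambda>i. n - i" "\<lambda>i. n - i"]) auto
  then show ?thesis by (simp add: no_powers_def coeff_mult_replicate)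
qed

lemma no_powers_add: "no_powers g f \<Longrightarrow> no_powers g h \<Longrightarrow> no_powers g (f + h)"
  and no_powers_diff: "no_powers g f \<Longrightarrow> no_powers g h \<Longrightarrow> no_powers g (f - h)"
  and no_powers_zero: "no_powers g 0"
  and no_powers_euler_op: "no_powers g f \<Longrightarrow> no_powers g (euler_op f)"
  and no_powers_mult_left: "no_powers g f \<Longrightarrow> no_powers g (h * f)"
  and no_powers_mult_right: "no_powers g f \<Longrightarrow> no_powers g (f * h)"
  by (simp_all add: no_powers_def coeff_mult_replicate coeff_euler_op)

text \<open>Values of a tangential derivation lie in the ideal generated by the commutators
  [g, c g], which maps to 0 in every commutative quotient; hence the letter \<open>h\<close> is
  arbitrary.\<close>

lemma no_powers_tder: "no_powers h (tder c f)"
proof -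
  have "no_powers h (tder_mono c w)" for w
  proof (induction w)
    case (Cons g w)
    then show ?case
      by (simp only: tder_mono_Cons no_powers_add no_powers_lieb no_powers_mult_left no_powers_mult_right)
  qed (simp add: tder_mono_def no_powers_zero)
  then show ?thesis by (simp add: no_powers_def coeff_tder)
qed

section \<open>Cyclic words and traces\<close>

definition rots :: "'a list \<Rightarrow> 'a list set" where
  "rots w = (\<lambda>n. rotate n w) ` {..<length w}"

lemma rots_eq: "rots w = (if w = [] then {} else {rotate n w | n. True})"
proof (cases "w = []")
  case False
  have "rotate n w = rotate (n mod length w) w" for n by (rule rotate_conv_mod)
  then show ?thesis
    using False by (auto simp: rots_def image_iff) (metis length_greater_0_conv lessThan_iff mod_less_divisor)
qed (simp add: rots_def)

lemma rots_self: "w \<noteq> [] \<Longrightarrow> w \<in> rots w"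
  by (auto simp: rots_eq intro: exI[of _ 0])

lemma rots_sym: "u \<in> rots w \<Longrightarrow> w \<in> rots u"
proof (cases "w = []")
  case False
  assume "u \<in> rots w"
  then obtain n where "n < length w" "u = rotate n w" by (auto simp: rots_def)
  then have "w = rotate (length w - n) u" by (simp add: rotate_rotate)
  then show ?thesis using False \<open>u = _\<close> unfolding rots_eq by (metis (mono_tags, lifting) mem_Collect_eq rotate_is_Nil_conv)
qed (simp add: rots_def)

lemma rots_subset: "u \<in> rots w \<Longrightarrow> rots u \<subseteq> rots w"
  by (auto simp: rots_eq rotate_rotate split: if_splits)

lemma rots_eq_iff: "w \<noteq> [] \<Longrightarrow> rots u = rots w \<longleftrightarrow> u \<in> rots w"
proof
  assume "w \<noteq> []" "rots u = rots w"
  then show "u \<in> rots w"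
    by (cases "u = []") (auto dest: rots_self simp: rots_def[of "[]"])
next
  assume "u \<in> rots w"
  then show "rots u = rots w" using rots_subset rots_sym by blast
qed

lemma length_rots: "u \<in> rots w \<Longrightarrow> length u = length w"
  by (auto simp: rots_def)

text \<open>A trace is kept as a series that is constant on rotation classes. In this way
  \<open>ord_ge\<close>, \<open>ser_sum\<close> and \<open>filt_lin\<close> apply to traces
  too.\<close>

definition trace :: "'k::field_char_0 nc \<Rightarrow> 'k nc" where
  "trace f = Nc (Tr (coeff f))"

lemma coeff_trace: "coeff (trace f) w = sum (coeff f) (rots w)"
  by (simp add: trace_def Tr_def rots_def)

lemma filt_lin_trace: "filt_lin trace"
  by (auto simp: filt_lin_def ord_ge_def coeff_trace sum.distrib sum_distrib_left length_rots intro!: nc_eqI sum.neutral)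

text \<open>A summand is given by a rotation of the word and a cut point. Exchanging the two pieces
  is an involution on these pairs, and it interchanges the roles of \<open>f\<close> and
  \<open>g\<close>.\<close>

lemma trace_mult_commute: "trace (f * g) = trace (g * f)"
proof (rule nc_eqI)
  fix w :: "gen list"
  let ?A = "rots w \<times> {..length w}"
  have sum: "coeff (trace (f * g)) w = (\<Sum>(v, i)\<in>?A. coeff f (take i v) * coeff g (drop i v))" for f g :: "'a nc"
    unfolding coeff_trace sum.cartesian_product[symmetric]
    by (rule sum.cong) (auto simp: coeff_mult length_rots)
  let ?s = "\<lambda>(v, i). (drop i v @ take i v, length v - i)"
  have s: "?s p \<in> ?A \<and> ?s (?s p) = p" if "p \<in> ?A" for p
  proof -
    obtain v i where p: "p = (v, i)" "v \<in> rots w" "i \<le> length v"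
      using \<open>p \<in> ?A\<close> by (auto simp: length_rots)
    have "v \<noteq> []" using p(2) by (auto dest: length_rots simp: rots_def)
    have "drop i v @ take i v = rotate i v"
      using rotate_append[of "take i v" "drop i v"] p(3) by (simp add: min_def split: if_splits)
    then have "drop i v @ take i v \<in> rots v"
      using \<open>v \<noteq> []\<close> by (auto simp: rots_eq)
    then have "drop i v @ take i v \<in> rots w" using rots_subset[OF p(2)] by blast
    then show ?thesis using p by (auto simp: length_rots)
  qed
  have "(\<Sum>(v, i)\<in>?A. coeff f (take i v) * coeff g (drop i v))
     = (\<Sum>(v, i)\<in>?A. coeff g (take i v) * coeff f (drop i v))"
    by (rule sum.reindex_bij_witness[of _ ?s ?s]) (use s in \<open>auto simp: mult.commute length_rots\<close>)
  then show "coeff (trace (f * g)) w = coeff (trace (g * f)) w" by (simp add: sum)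
qed

lemma trace_lieb: "trace (lieb f g) = 0"
  by (simp add: filt_lin_diff[OF filt_lin_trace] trace_mult_commute)

text \<open>Derivations act on the quotient by commutators: the trace of \<open>T (mono w)\<close> depends on the
  cyclic word of \<open>w\<close> only, so the sum over \<open>w\<close> can be grouped by cyclic words.\<close>
lemma trace_derivation:
  assumes T: "derivation T" and f: "trace f = 0"
  shows "trace (T f) = 0"
proof (rule nc_eqI)
  fix v :: "gen list"
  let ?W = "{w :: gen list. length w < Suc (length v)}"
  let ?c = "\<lambda>w. coeff (trace (T (mono w))) v"
  have c: "?c u = ?c w" if "u \<in> rots w" for u w
  proof -
    obtain n where "u = rotate n w" using \<open>u \<in> rots w\<close> by (auto simp: rots_def)
    then obtain p q where "w = p @ q" "u = q @ p"
      by (metis (no_types) rotate_drop_take append_take_drop_id)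
    then have "T (mono u) = T (mono q) * mono p + mono q * T (mono p)"
      and "T (mono w) = T (mono p) * mono q + mono p * T (mono q)"
      by (simp_all only: mono_append derivation_mult[OF T])
    then show ?thesis
      using trace_mult_commute[of "T (mono q)" "mono p"] trace_mult_commute[of "T (mono p)" "mono q"]
      by (simp add: filt_lin_add[OF filt_lin_trace])
  qed
  have "coeff (trace (T f)) v = (\<Sum>w\<in>?W. coeff f w * ?c w)"
    by (rule filt_lin_coeff[OF filt_lin_compose[OF filt_lin_trace derivation_filt_lin[OF T]] lessI])
  also have "\<dots> = (\<Sum>R\<in>rots ` ?W. \<Sum>w\<in>{w \<in> ?W. rots w = R}. coeff f w * ?c w)"
    by (rule sum.image_gen[OF finite_words(2)])
  also have "\<dots> = 0"
  proof (rule sum.neutral, rule ballI)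
    fix R assume "R \<in> rots ` ?W"
    then obtain u where u: "u \<in> ?W" "R = rots u" by blast
    show "(\<Sum>w\<in>{w \<in> ?W. rots w = R}. coeff f w * ?c w) = 0"
    proof (cases "u = []")
      \<comment> \<open>A vanishing trace says nothing about the coefficient at the empty word; this
        term disappears because \<open>T\<close> kills constants.\<close>
      case True
      then have "R = {}" using u by (simp add: rots_def)
      show ?thesis
      proof (intro sum.neutral ballI)
        fix w assume "w \<in> {w \<in> ?W. rots w = R}"
        then have "w = []" using rots_self[of w] \<open>R = {}\<close> by blast
        then show "coeff f w * ?c w = 0"
          by (simp add: mono_Nil derivation_one[OF T] filt_lin_zero[OF filt_lin_trace])
      qed
    next
      case False
      then have "w \<in> {w \<in> ?W. rots w = R} \<longleftrightarrow> w \<in> rots u" for w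
        using u rots_eq_iff[OF False, of w] length_rots[of w u] by auto
      then have "{w \<in> ?W. rots w = R} = rots u" by blast
      then have "(\<Sum>w\<in>{w \<in> ?W. rots w = R}. coeff f w * ?c w) = (\<Sum>w\<in>rots u. coeff f w * ?c u)"
        using c by (intro sum.cong) metis+
      also have "\<dots> = coeff (trace f) u * ?c u" unfolding coeff_trace by (simp only: sum_distrib_right)
      finally show ?thesis unfolding f by simp
    qed
  qed
  finally show "coeff (trace (T f)) v = coeff 0 v" by simp
qed

lemma trace_derivation_cong: "derivation T \<Longrightarrow> trace f = trace g \<Longrightarrow> trace (T f) = trace (T g)"
  using trace_derivation[of T "f - g"]
  by (simp add: filt_lin_diff[OF filt_lin_trace] filt_lin_diff[OF derivation_filt_lin])

lemma trace_euler_op: "trace (euler_op f) = euler_op (trace f)"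
  unfolding coeff_trace coeff_euler_op by (rule nc_eqI) (simp add: coeff_trace coeff_euler_op sum_distrib_left length_rots cong: sum.cong)

section \<open>The divergence cocycle and conjugation of the Euler derivation\<close>

text \<open>The operator \<partial> of the decomposition of a series by its last letter, from which
  the divergence is built.\<close>

definition rpartial :: "gen \<Rightarrow> 'k::field_char_0 nc \<Rightarrow> 'k nc" where
  "rpartial g f = Nc (\<lambda>w. coeff f (w @ [g]))"

lemma coeff_rpartial: "coeff (rpartial g f) w = coeff f (w @ [g])"
  by (simp add: rpartial_def)

lemma rpartial_add: "rpartial g (f + h) = rpartial g f + rpartial g h"
  and rpartial_diff: "rpartial g (f - h) = rpartial g f - rpartial g h"
  and rpartial_scl: "rpartial g (scl r f) = scl r (rpartial g f)"
  by (rule nc_eqI; simp add: coeff_rpartial)+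

lemma rpartial_sum: "rpartial g (sum h I) = (\<Sum>i\<in>I. rpartial g (h i))"
  by (rule nc_eqI) (simp add: coeff_rpartial)

text \<open>Fox's product rule, with the constant term as augmentation: the last letter comes from
  \<open>h\<close> unless \<open>h\<close> contributes its constant term.\<close>

lemma rpartial_mult: "rpartial g (f * h) = f * rpartial g h + scl (coeff h []) (rpartial g f)"
  by (rule nc_eqI) (simp add: coeff_rpartial coeff_mult_snoc rpartial_def[of g h])

lemma rpartial_gn: "rpartial g (gn h) = (if g = h then 1 else 0)"
  by (rule nc_eqI) (simp add: coeff_rpartial coeff_mono coeff_one)

lemma rpartial_expand: "f = scl (coeff f []) 1 + (\<Sum>g\<in>UNIV. rpartial g f * gn g)"
proof (rule nc_eqI)
  fix v show "coeff f v = coeff (scl (coeff f []) 1 + (\<Sum>g\<in>UNIV. rpartial g f * gn g)) v"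
  proof (cases v rule: rev_cases)
    case Nil
    then show ?thesis by (simp add: coeff_one coeff_mult_gn(2) coeff_mono)
  next
    case (snoc w h)
    have "coeff f v = (\<Sum>g\<in>UNIV. if h = g then coeff f v else 0)" by (simp add: sum.delta)
    also have "\<dots> = (\<Sum>g\<in>UNIV. coeff (rpartial g f * gn g) v)"
      unfolding snoc coeff_mult_gn(1) by (rule sum.cong) (simp_all add: coeff_rpartial)
    finally show ?thesis by (simp add: snoc coeff_one)
  qed
qed

definition div_nc :: "(gen \<Rightarrow> 'k::field_char_0 nc) \<Rightarrow> 'k nc" where
  "div_nc c = (\<Sum>g\<in>UNIV. gn g * rpartial g (c g))"

text \<open>\<open>rpartial\<close> alone lowers the degree by one. The factor \<open>gn g\<close>
  compensates, so the divergence is handled through this composite.\<close>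

lemma filt_lin_gn_rpartial: "filt_lin (\<lambda>f. gn g * rpartial g f)"
proof -
  have "ord_ge n (gn g * rpartial g f)" if "ord_ge n f" for n and f :: "'a nc"
    unfolding ord_ge_def
  proof (intro allI impI)
    fix v :: "gen list" assume "length v < n"
    then show "coeff (gn g * rpartial g f) v = 0"
      using ogD[OF that] by (cases v) (auto simp: coeff_gn_mult(1) coeff_rpartial coeff_mono)
  qed
  then show ?thesis by (simp add: filt_lin_def rpartial_add rpartial_scl distrib_left)
qed

lemma div_nc_zero: "div_nc (\<lambda>g. 0) = 0"
  by (simp add: div_nc_def filt_lin_zero[OF filt_lin_gn_rpartial])

lemma div_nc_euler_op: "div_nc (\<lambda>g. euler_op (c g)) = euler_op (div_nc c)"
proof -
  have "gn g * rpartial g (euler_op f) = euler_op (gn g * rpartial g f)" for g and f :: "'a nc"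
  proof (rule nc_eqI)
    fix v show "coeff (gn g * rpartial g (euler_op f)) v = coeff (euler_op (gn g * rpartial g f)) v"
      by (cases v) (simp_all add: coeff_gn_mult(1) coeff_rpartial coeff_euler_op coeff_mono)
  qed
  then show ?thesis by (simp add: div_nc_def filt_lin_sum[OF derivation_filt_lin[OF derivation_euler_op]])
qed

text \<open>Expand \<open>f\<close> by last letters, apply the derivation and read off the last
  letter again. In [g, c g] the product g (c g) ends inside the component and yields the sum, while
  (c g) g ends in g and yields the subtracted term.\<close>

lemma rpartial_tder:
  assumes c: "\<And>g. ord_ge (Suc 0) (c g)"
  shows "rpartial k (tder c f) = tder c (rpartial k f) + (\<Sum>g\<in>UNIV. rpartial g f * gn g * rpartial k (c g)) - rpartial k f * c k"
proof -
  note D = derivation_tder[of c, OF c]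
  have c0: "coeff (c g) [] = 0" for g using c by (simp add: ord_ge_Suc_0)
  have "tder c f = (\<Sum>g\<in>UNIV. tder c (rpartial g f) * gn g + rpartial g f * lieb (gn g) (c g))"
    by (subst rpartial_expand[of f])
      (simp add: filt_lin_add[OF filt_lin_tder] filt_lin_scl[OF filt_lin_tder] filt_lin_sum[OF filt_lin_tder] derivation_one[OF D]
        derivation_mult[OF D] tder_gn[of c, OF c])
  then have "rpartial k (tder c f) = (\<Sum>g\<in>UNIV. (if k = g then tder c (rpartial g f) - rpartial g f * c g else 0)
      + rpartial g f * gn g * rpartial k (c g))"
    by (simp add: rpartial_sum rpartial_add rpartial_diff rpartial_mult rpartial_gn c0 coeff_mono right_diff_distrib mult.assoc
        cong: if_cong) (rule sum.cong, simp_all add: c0)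
  also have "\<dots> = tder c (rpartial k f) - rpartial k f * c k + (\<Sum>g\<in>UNIV. rpartial g f * gn g * rpartial k (c g))"
    by (simp add: sum.distrib sum.delta)
  finally show ?thesis by simp
qed

text \<open>By the Jacobi identity the components on the left are those of the commutator of
  \<open>tder c\<close> and \<open>tder d\<close>. Besides the right side, the product rule produces
  commutators, which the trace kills, and the double sums of \<open>M\<close>. With the matrices J_c
  whose (k, g) entry is k \<partial>_g (c k), these double sums are the traces of J_d J_c and J_c
  J_d, and they cancel by cyclicity.\<close>

lemma div_nc_cocycle:
  assumes c: "\<And>g. ord_ge (Suc 0) (c g)" and d: "\<And>g. ord_ge (Suc 0) (d g)"
  shows "trace (div_nc (\<lambda>g. tder c (d g) - tder d (c g) + lieb (c g) (d g))) = trace (tder c (div_nc d) - tder d (div_nc c))"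
proof -
  define M where "M c d g k = gn g * (rpartial k (d g) * gn k * rpartial g (c k))" for c d :: "gen \<Rightarrow> 'a nc" and g k
  have c0: "coeff (c g) [] = 0" and d0: "coeff (d g) [] = 0" for g
    using c d by (simp_all add: ord_ge_Suc_0)
  note mult = derivation_mult[OF derivation_tder[of c, OF c]] derivation_mult[OF derivation_tder[of d, OF d]]
  have summand: "gn g * rpartial g (tder c (d g) - tder d (c g) + lieb (c g) (d g))
    = tder c (gn g * rpartial g (d g)) - tder d (gn g * rpartial g (c g))
      + lieb (c g) (gn g * rpartial g (d g)) - lieb (d g) (gn g * rpartial g (c g))
      + (\<Sum>k\<in>UNIV. M c d g k) - (\<Sum>k\<in>UNIV. M d c g k)" for g
    unfolding M_def sum_distrib_left[symmetric]
    by (simp add: rpartial_add rpartial_diff rpartial_mult c0 d0 rpartial_tder[of c, OF c] rpartial_tder[of d, OF d] mult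
        tder_gn[of c, OF c] tder_gn[of d, OF d] algebra_simps)
  have "trace (M c d g k) = trace (M d c k g)" for g k
    using trace_mult_commute[of "gn g * rpartial k (d g)" "gn k * rpartial g (c k)"] by (simp add: M_def mult.assoc)
  then have "(\<Sum>g\<in>UNIV. \<Sum>k\<in>UNIV. trace (M c d g k)) = (\<Sum>g\<in>UNIV. \<Sum>k\<in>UNIV. trace (M d c k g))"
    by simp
  also have "\<dots> = (\<Sum>g\<in>UNIV. \<Sum>k\<in>UNIV. trace (M d c g k))" by (rule sum.swap)
  finally have M: "(\<Sum>g\<in>UNIV. \<Sum>k\<in>UNIV. trace (M c d g k)) = (\<Sum>g\<in>UNIV. \<Sum>k\<in>UNIV. trace (M d c g k))" .
  have "trace (div_nc (\<lambda>g. tder c (d g) - tder d (c g) + lieb (c g) (d g)))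
    = (\<Sum>g\<in>UNIV. trace (tder c (gn g * rpartial g (d g))) - trace (tder d (gn g * rpartial g (c g)))
      + (\<Sum>k\<in>UNIV. trace (M c d g k)) - (\<Sum>k\<in>UNIV. trace (M d c g k)))"
    unfolding div_nc_def summand filt_lin_sum[OF filt_lin_trace] filt_lin_add[OF filt_lin_trace] filt_lin_diff[OF filt_lin_trace]
    by (simp add: trace_mult_commute[of "_ * _" "c _"] trace_mult_commute[of "_ * _" "d _"])
  also have "\<dots> = (\<Sum>g\<in>UNIV. trace (tder c (gn g * rpartial g (d g)))) - (\<Sum>g\<in>UNIV. trace (tder d (gn g * rpartial g (c g))))"
    unfolding sum.distrib sum_subtractf M by simp
  also have "\<dots> = trace (tder c (div_nc d) - tder d (div_nc c))"
    by (simp only: div_nc_def filt_lin_sum[OF filt_lin_tder] filt_lin_sum[OF filt_lin_trace] filt_lin_diff[OF filt_lin_trace])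
  finally show ?thesis .
qed

text \<open>With \<open>D = tder c\<close> and \<open>l = euler_op\<close>, \<open>ad_euler_op c n\<close> is \<open>(ad D)\<^sup>n l\<close>; for \<open>n > 0\<close> it is the tangential
  derivation given by \<open>ad_fld c n\<close>.\<close>

primrec ad_euler_op :: "(gen \<Rightarrow> 'k::field_char_0 nc) \<Rightarrow> nat \<Rightarrow> 'k nc \<Rightarrow> 'k nc" where
  "ad_euler_op c 0 = euler_op"
| "ad_euler_op c (Suc n) = (\<lambda>f. tder c (ad_euler_op c n f) - ad_euler_op c n (tder c f))"

primrec ad_fld :: "(gen \<Rightarrow> 'k::field_char_0 nc) \<Rightarrow> nat \<Rightarrow> gen \<Rightarrow> 'k nc" where
  "ad_fld c 0 = (\<lambda>g. 0)"
| "ad_fld c (Suc n) = (\<lambda>g. tder c (ad_fld c n g) - ad_euler_op c n (c g) + lieb (c g) (ad_fld c n g))"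

text \<open>This is exp(ad D) l, written as a series so that it makes sense before any inverse of
  exp D is available.\<close>

definition conj_euler_op :: "(gen \<Rightarrow> 'k::field_char_0 nc) \<Rightarrow> 'k nc \<Rightarrow> 'k nc" where
  "conj_euler_op c f = ser_sum (\<lambda>n. scl (1 / fact n) (ad_euler_op c n f))"

definition conj_fld :: "(gen \<Rightarrow> 'k::field_char_0 nc) \<Rightarrow> gen \<Rightarrow> 'k nc" where
  "conj_fld c g = ser_sum (\<lambda>n. scl (1 / fact n) (ad_fld c n g))"

text \<open>A representative of j(exp D) in the associative algebra; the trace is taken
  afterwards.\<close>

definition j_series :: "(gen \<Rightarrow> 'k::field_char_0 nc) \<Rightarrow> 'k nc" where
  "j_series c = ser_sum (\<lambda>n. scl (1 / fact (Suc n)) ((tder c ^^ n) (div_nc c)))"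

lemma raises_ad_euler_op: "raises n (ad_euler_op c n)"
proof (induction n)
  case 0
  then show ?case by (simp add: raises_def filt_lin_ord_ge[OF derivation_filt_lin[OF derivation_euler_op]])
next
  case (Suc n)
  show ?case
    unfolding raises_def
  proof (intro allI impI)
    fix m and f :: "'a nc" assume f: "ord_ge m f"
    have "ord_ge (Suc (n + m)) (tder c (ad_euler_op c n f))" "ord_ge (n + Suc m) (ad_euler_op c n (tder c f))"
      by (intro raises_1D[OF raises_tder] raisesD[OF Suc.IH] f)+
    then show "ord_ge (Suc n + m) (ad_euler_op c (Suc n) f)" by (simp add: ord_ge_diff)
  qed
qed

lemma filt_lin_ad_euler_op: "filt_lin (ad_euler_op c n)"
proof (induction n)
  case 0
  then show ?case by (simp add: derivation_filt_lin[OF derivation_euler_op])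
next
  case (Suc n)
  then show ?case by (simp add: filt_lin_minus filt_lin_compose[OF filt_lin_tder] filt_lin_compose[OF _ filt_lin_tder])
qed

lemma ser_summable_ad_euler_op: "ser_summable (\<lambda>n. scl (r n) (ad_euler_op c n f))"
  using raisesD[OF raises_ad_euler_op, of 0 f] by (simp add: ser_summable_def ord_ge_scl)

lemma ord_ge_ad_fld:
  assumes c: "\<And>g. ord_ge (Suc 0) (c g)"
  shows "ord_ge n (ad_fld c n g)"
proof (induction n)
  case (Suc n)
  have "ord_ge (Suc n) (tder c (ad_fld c n g))" by (rule raises_1D[OF raises_tder Suc.IH])
  moreover have "ord_ge (n + Suc 0) (ad_euler_op c n (c g))" by (rule raisesD[OF raises_ad_euler_op c])
  moreover have "ord_ge (Suc 0 + n) (c g * ad_fld c n g)" "ord_ge (n + Suc 0) (ad_fld c n g * c g)"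
    by (intro ord_ge_mult c Suc.IH)+
  ultimately show ?case by (simp add: ord_ge_add ord_ge_diff)
qed simp

lemma ser_summable_ad_fld:
  assumes "\<And>g. ord_ge (Suc 0) (c g)"
  shows "ser_summable (\<lambda>n. scl (r n) (ad_fld c n g))"
  by (simp add: ser_summable_def ord_ge_scl ord_ge_ad_fld[of c, OF assms])

lemma derivation_ad_euler_op:
  assumes c: "\<And>g. ord_ge (Suc 0) (c g)"
  shows "derivation (ad_euler_op c n)"
  by (induction n) (simp_all add: derivation_euler_op derivation_commutator derivation_tder[of c, OF c])

text \<open>At n = 0 the operator l fixes the generators and has no tangential part. The first
  commutator gives [D, l](g) = - [g, l (c g)], which fits the recursion with zero start. From then
  on the Jacobi identity [[g,c],p] - [[g,p],c] = [g,[c,p]] gives the bracket term of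
  \<open>ad_fld\<close>.\<close>

lemma ad_euler_op_gn:
  assumes c: "\<And>g. ord_ge (Suc 0) (c g)"
  shows "ad_euler_op c n (gn g) = (if n = 0 then gn g else 0) + lieb (gn g) (ad_fld c n g)"
proof (induction n)
  case 0
  then show ?case by (simp add: euler_op_gn)
next
  case (Suc n)
  note D = derivation_tder[of c, OF c] and S = derivation_ad_euler_op[of c n, OF c]
  note simps = filt_lin_add[OF filt_lin_tder] filt_lin_diff[OF filt_lin_tder] derivation_mult[OF D] derivation_mult[OF S]
    filt_lin_diff[OF filt_lin_ad_euler_op] tder_gn[of c, OF c] Suc.IH filt_lin_zero[OF filt_lin_tder] euler_op_gn derivation_mult[OF derivation_euler_op] filt_lin_diff[OF derivation_filt_lin[OF derivation_euler_op]]
  show ?case by (cases "n = 0") (simp_all add: simps algebra_simps)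
qed

lemma no_powers_ord_ge_all: "(\<And>g. no_powers g (c g)) \<Longrightarrow> ord_ge (Suc 0) (c h)"
  by (blast intro: no_powers_ord_ge)

lemma ad_euler_op_eq_tder:
  assumes c: "\<And>g. ord_ge (Suc 0) (c g)" and n: "n > 0"
  shows "ad_euler_op c n f = tder (ad_fld c n) f"
proof -
  have p: "ord_ge (Suc 0) (ad_fld c n g)" for g
    using ord_ge_le[OF ord_ge_ad_fld[of c, OF c]] n by (metis Suc_leI)
  show ?thesis
    by (rule derivation_eqI[where f = f, OF derivation_ad_euler_op[of c, OF c] derivation_tder[of "ad_fld c n", OF p]])
      (use n in \<open>simp add: ad_euler_op_gn[of c, OF c] tder_gn[of "ad_fld c n", OF p]\<close>)
qed

lemma no_powers_ad_fld:
  assumes c: "\<And>g. no_powers g (c g)"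
  shows "no_powers g (ad_fld c n g)"
proof (induction n)
  case (Suc n)
  \<comment> \<open>For n = 0 the Euler operator only rescales coefficients; for n > 0 the operator
    is a tangential derivation, with values in the commutator ideal.\<close>
  have "no_powers g (ad_euler_op c n (c g))"
    by (cases n) (simp_all add: no_powers_euler_op c no_powers_diff no_powers_tder
        ad_euler_op_eq_tder[of c, OF no_powers_ord_ge_all[of c, OF c], of "Suc _", simplified ad_euler_op.simps])
  then show ?case by (simp only: ad_fld.simps no_powers_add no_powers_diff no_powers_tder no_powers_lieb)
qed (simp add: no_powers_zero)

lemma no_powers_conj_fld:
  assumes "\<And>g. no_powers g (c g)"
  shows "no_powers g (conj_fld c g)"
  using no_powers_ad_fld[of c, OF assms] by (simp add: no_powers_def conj_fld_def coeff_ser_sum)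

lemma derivation_conj_euler_op:
  assumes c: "\<And>g. ord_ge (Suc 0) (c g)"
  shows "derivation (conj_euler_op c)"
proof -
  have "conj_euler_op c (f * g) = conj_euler_op c f * g + f * conj_euler_op c g" for f g
    by (simp add: conj_euler_op_def filt_lin_ser_sum[OF filt_lin_mult_left ser_summable_ad_euler_op] filt_lin_ser_sum[OF filt_lin_mult_right ser_summable_ad_euler_op]
        derivation_mult[OF derivation_ad_euler_op[of c, OF c]] flip: ser_sum_add)
  moreover have "filt_lin (conj_euler_op c)"
    unfolding conj_euler_op_def[abs_def] by (intro filt_lin_ser_sum_fun filt_lin_scl_fun filt_lin_ad_euler_op)
  ultimately show ?thesis by (simp add: derivation_def)
qed

lemma conj_euler_op_eq:
  assumes c: "\<And>g. no_powers g (c g)"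
  shows "conj_euler_op c f = euler_op f + tder (conj_fld c) f"
proof -
  note c' = no_powers_ord_ge_all[of c, OF c]
  note q = no_powers_ord_ge_all[of "conj_fld c", OF no_powers_conj_fld[of c, OF c]]
  have gn: "conj_euler_op c (gn g) = gn g + lieb (gn g) (conj_fld c g)" for g
  proof -
    have "scl (1 / fact n) (ad_euler_op c n (gn g)) = (if n = 0 then gn g else 0)
        + lieb (gn g) (scl (1 / fact n) (ad_fld c n g))" for n
      by (simp add: ad_euler_op_gn[of c, OF c'])
    then show ?thesis
      by (simp add: conj_euler_op_def conj_fld_def ser_sum_add ser_sum_diff ser_sum_single
          filt_lin_ser_sum[OF filt_lin_mult_left ser_summable_ad_fld[of c, OF c']] filt_lin_ser_sum[OF filt_lin_mult_right ser_summable_ad_fld[of c, OF c']])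
  qed
  show ?thesis
    by (rule derivation_eqI[where f = f, OF derivation_conj_euler_op[of c, OF c']
          derivation_plus[OF derivation_euler_op derivation_tder[of "conj_fld c", OF q]]])
      (simp add: gn euler_op_gn tder_gn[of "conj_fld c", OF q])
qed

text \<open>\<open>conj_euler_op c\<close> is \<open>F l F\<inverse>\<close> for \<open>F = exp D\<close>.\<close>
lemma conj_euler_op_expo: "conj_euler_op c (expo (tder c) f) = expo (tder c) (euler_op f)"
proof -
  \<comment> \<open>The array is h i j = ((ad D)^i l) (D^j f). The rule that D must satisfy on it is
    the definition of the commutator, solved for D applied to a value.\<close>
  have "expo (tder c) (ad_euler_op c 0 ((tder c ^^ 0) f))
    = ser_sum (\<lambda>i. ser_sum (\<lambda>j. scl (1 / (fact i * fact j)) (ad_euler_op c i ((tder c ^^ j) f))))"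
    by (rule expo_binomial[OF filt_lin_tder]) (simp_all add: raisesD[OF raises_ad_euler_op] ord_ge_funpow[OF raises_tder])
  also have "\<dots> = conj_euler_op c (expo (tder c) f)"
    by (simp add: conj_euler_op_def expo_def filt_lin_ser_sum[OF filt_lin_ad_euler_op ser_summable_expo[OF raises_tder]]
        filt_lin_scl[OF filt_lin_ad_euler_op] flip: ser_sum_scl)
  finally show ?thesis by simp
qed

text \<open>For n > 0 this is the cocycle property. For n = 0 the operator l is not tangential and
  \<open>ad_fld c 0\<close> does not represent it; there the formula holds because l commutes with
  the divergence.\<close>

lemma div_nc_ad_fld_Suc:
  assumes c: "\<And>g. ord_ge (Suc 0) (c g)"
  shows "trace (div_nc (ad_fld c (Suc n))) = trace (tder c (div_nc (ad_fld c n)) - ad_euler_op c n (div_nc c))"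
proof (cases "n = 0")
  case True
  have "div_nc (\<lambda>g. - euler_op (c g)) = - euler_op (div_nc c)"
    unfolding div_nc_euler_op[symmetric] by (simp add: div_nc_def filt_lin_uminus[OF filt_lin_gn_rpartial] sum_negf)
  then show ?thesis using True by (simp add: div_nc_zero filt_lin_zero[OF filt_lin_tder])
next
  case False
  have p: "ord_ge (Suc 0) (ad_fld c n g)" for g
    using ord_ge_le[OF ord_ge_ad_fld[of c, OF c]] False by (metis Suc_leI neq0_conv)
  show ?thesis
    using div_nc_cocycle[of c "ad_fld c n", OF c p] False ad_euler_op_eq_tder[of c, OF c] by simp
qed

text \<open>Unrolling the preceding recursion gives minus the sum over i of D^(N-i) applied to ((ad
  D)^i l)(div c). Moving each D inwards produces the coefficients C(N-i, m), which the hockey-stick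
  identity adds up to C(N+1, m+1). The induction carries this out with Pascal's rule.\<close>

lemma trace_div_nc_ad_fld:
  assumes c: "\<And>g. ord_ge (Suc 0) (c g)"
  shows "trace (div_nc (ad_fld c (Suc N))) =
    - trace (\<Sum>m\<le>N. scl (of_nat (Suc N choose Suc m)) (ad_euler_op c (N - m) ((tder c ^^ m) (div_nc c))))"
proof (induction N)
  case 0
  have "div_nc (ad_fld c 0) = 0" by (simp add: div_nc_zero)
  then show ?case
    unfolding div_nc_ad_fld_Suc[of c, OF c] by (simp add: filt_lin_zero[OF filt_lin_tder] filt_lin_uminus[OF filt_lin_trace])
next
  case (Suc N)
  let ?s = "\<lambda>i m. ad_euler_op c i ((tder c ^^ m) (div_nc c))"
  define Q where "Q N = (\<Sum>m\<le>N. scl (of_nat (Suc N choose Suc m)) (?s (N - m) m))" for N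
  have Q: "Q (Suc N) = ad_euler_op c (Suc N) (div_nc c) + tder c (Q N)"
  proof -
    have "tder c (Q N) = (\<Sum>m\<le>N. scl (of_nat (Suc N choose Suc m)) (?s (Suc N - m) m)
        + scl (of_nat (Suc N choose Suc m)) (?s (N - m) (Suc m)))"
      unfolding Q_def filt_lin_sum[OF filt_lin_tder] filt_lin_scl[OF filt_lin_tder]
      by (rule sum.cong) (simp_all add: Suc_diff_le del: binomial_Suc_Suc)
    also have "\<dots> = (\<Sum>m\<le>Suc N. scl (of_nat (Suc N choose Suc m)) (?s (Suc N - m) m))
        + (\<Sum>m\<le>N. scl (of_nat (Suc N choose Suc m)) (?s (N - m) (Suc m)))"
      unfolding sum.distrib by (simp add: binomial_eq_0 del: binomial_Suc_Suc ad_euler_op.simps)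
    finally have DQ: "tder c (Q N) = \<dots>" .
    have shift: "ad_euler_op c (Suc N) (div_nc c) + (\<Sum>m\<le>N. scl (of_nat (Suc N choose Suc m)) (?s (N - m) (Suc m)))
        = (\<Sum>m\<le>Suc N. scl (of_nat (Suc N choose m)) (?s (Suc N - m) m))"
      unfolding sum.atMost_Suc_shift[of "\<lambda>m. scl (of_nat (Suc N choose m)) (?s (Suc N - m) m)"]
      by (simp only: diff_zero diff_Suc_Suc binomial_n_0 of_nat_1 scl_simps funpow_0)
    have "ad_euler_op c (Suc N) (div_nc c) + tder c (Q N)
        = (\<Sum>m\<le>Suc N. scl (of_nat (Suc N choose Suc m)) (?s (Suc N - m) m))
          + (\<Sum>m\<le>Suc N. scl (of_nat (Suc N choose m)) (?s (Suc N - m) m))"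
      by (simp only: DQ add.left_commute[of "ad_euler_op c (Suc N) (div_nc c)"] shift)
    also have "\<dots> = Q (Suc N)"
      unfolding Q_def sum.distrib[symmetric]
    proof (rule sum.cong)
      fix m
      have "scl (of_nat (Suc N choose Suc m)) f + scl (of_nat (Suc N choose m)) f
        = scl (of_nat (Suc (Suc N) choose Suc m)) f" for f :: "'a nc"
        by (rule nc_eqI) (simp add: algebra_simps)
      then show "scl (of_nat (Suc N choose Suc m)) (?s (Suc N - m) m) + scl (of_nat (Suc N choose m)) (?s (Suc N - m) m)
        = scl (of_nat (Suc (Suc N) choose Suc m)) (?s (Suc N - m) m)" .
    qed simp
    finally show ?thesis by simp
  qed
  \<comment> \<open>The induction hypothesis is an equation of traces only. Since derivations
    descend to traces, D may still be applied to both sides.\<close>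
  have "trace (tder c (div_nc (ad_fld c (Suc N)))) = trace (tder c (- Q N))"
    by (rule trace_derivation_cong[OF derivation_tder[of c, OF c]]) (simp only: Suc.IH Q_def filt_lin_uminus[OF filt_lin_trace])
  then have "trace (tder c (div_nc (ad_fld c (Suc N)))) = - trace (tder c (Q N))"
    by (simp only: filt_lin_uminus[OF filt_lin_trace] filt_lin_uminus[OF filt_lin_tder])
  then have "trace (div_nc (ad_fld c (Suc (Suc N)))) = - trace (Q (Suc N))"
    unfolding div_nc_ad_fld_Suc[of c "Suc N", OF c] Q filt_lin_diff[OF filt_lin_trace] filt_lin_add[OF filt_lin_trace] by simp
  then show ?case by (simp only: Q_def)
qed

text \<open>Dividing by (N+1)! makes the binomial sum a Cauchy product: 1/(N-m)! weights (ad
  D)^(N-m) l and 1/(m+1)! weights D^m (div c). So the product of exp(ad D) l with the series for j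
  appears.\<close>

lemma trace_div_nc_conj_fld:
  assumes c: "\<And>g. ord_ge (Suc 0) (c g)"
  shows "trace (div_nc (conj_fld c)) = - trace (conj_euler_op c (j_series c))"
proof -
  let ?d = "\<lambda>n. scl (1 / fact n) (trace (div_nc (ad_fld c n)))"
  let ?h = "\<lambda>i m. scl (1 / (fact i * fact (Suc m))) (ad_euler_op c i ((tder c ^^ m) (div_nc c)))"
  have ord_ge_div_nc: "ord_ge n (div_nc (ad_fld c n))" for n
    unfolding div_nc_def by (intro ord_ge_sum filt_lin_ord_ge[OF filt_lin_gn_rpartial] ord_ge_ad_fld[of c, OF c])
  have "div_nc (conj_fld c) = ser_sum (\<lambda>n. scl (1 / fact n) (div_nc (ad_fld c n)))"
    by (rule nc_eqI)
      (simp add: div_nc_def conj_fld_def filt_lin_ser_sum[OF filt_lin_gn_rpartial ser_summable_ad_fld[of c, OF c]] coeff_ser_sum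
        filt_lin_scl[OF filt_lin_gn_rpartial] scl_sum sum.swap[of _ UNIV])
  then have "trace (div_nc (conj_fld c)) = ser_sum ?d"
    using ord_ge_div_nc by (simp add: filt_lin_ser_sum[OF filt_lin_trace] ser_summable_def ord_ge_scl filt_lin_scl[OF filt_lin_trace])
  also have "\<dots> = ser_sum (\<lambda>N. ?d (Suc N))"
  proof (rule ser_sum_shift)
    show "?d 0 = 0" by (simp add: div_nc_zero filt_lin_zero[OF filt_lin_trace])
    show "ord_ge (Suc n) (?d (Suc n))" for n by (intro ord_ge_scl filt_lin_ord_ge[OF filt_lin_trace] ord_ge_div_nc)
  qed
  also have "\<dots> = ser_sum (\<lambda>N. - trace (\<Sum>i\<le>N. ?h i (N - i)))"
  proof -
    have "scl (1 / fact (Suc N)) (\<Sum>m\<le>N. scl (of_nat (Suc N choose Suc m)) (ad_euler_op c (N - m) ((tder c ^^ m) (div_nc c))))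
       = (\<Sum>i\<le>N. ?h i (N - i))" for N
      unfolding scl_sum
    proof (rule sum.reindex_bij_witness[of _ "\<lambda>i. N - i" "\<lambda>i. N - i"])
      fix m assume m: "m \<in> {..N}"
      then have "1 / fact (Suc N) * of_nat (Suc N choose Suc m) = (1 / (fact (N - m) * fact (Suc m)) :: 'a)"
        by (simp add: binomial_fact del: fact_Suc binomial_Suc_Suc)
      then show "?h (N - m) (N - (N - m)) = scl (1 / fact (Suc N)) (scl (of_nat (Suc N choose Suc m))
          (ad_euler_op c (N - m) ((tder c ^^ m) (div_nc c))))"
        using m by (simp del: fact_Suc binomial_Suc_Suc)
    qed auto
    then show ?thesis
      unfolding trace_div_nc_ad_fld[of c, OF c] by (simp only: filt_lin_scl[OF filt_lin_trace, symmetric] scl_simps)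
  qed
  also have "\<dots> = - trace (ser_sum (\<lambda>N. \<Sum>i\<le>N. ?h i (N - i)))"
  proof -
    have "ord_ge (i + m) (?h i m)" for i m
      by (intro ord_ge_scl raisesD[OF raises_ad_euler_op] ord_ge_funpow[OF raises_tder])
    then have "ord_ge N (?h i (N - i))" if "i \<le> N" for i N
      using that by (metis le_add_diff_inverse)
    then have "ser_summable (\<lambda>N. \<Sum>i\<le>N. ?h i (N - i))"
      unfolding ser_summable_def by (auto intro!: ord_ge_sum simp del: fact_Suc)
    then show ?thesis by (simp only: filt_lin_ser_sum[OF filt_lin_trace] ser_sum_uminus)
  qed
  also have "ser_sum (\<lambda>N. \<Sum>i\<le>N. ?h i (N - i)) = ser_sum (\<lambda>i. ser_sum (?h i))"
    by (rule ser_sum_ser_sum[symmetric]) (intro ord_ge_scl raisesD[OF raises_ad_euler_op] ord_ge_funpow[OF raises_tder])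
  also have "\<dots> = conj_euler_op c (j_series c)"
    by (simp add: conj_euler_op_def j_series_def filt_lin_ser_sum[OF filt_lin_ad_euler_op ser_summable_expo[OF raises_tder]]
        filt_lin_scl[OF filt_lin_ad_euler_op] del: fact_Suc flip: ser_sum_scl)
  finally show ?thesis .
qed

section \<open>Exponentials and logarithms\<close>

definition pow_ser :: "(nat \<Rightarrow> 'k) \<Rightarrow> 'k::field_char_0 nc \<Rightarrow> 'k nc" where
  "pow_ser a h = ser_sum (\<lambda>n. scl (a n) (h ^ n))"

abbreviation nexp :: "'k::field_char_0 nc \<Rightarrow> 'k nc" where
  "nexp \<equiv> pow_ser (\<lambda>n. 1 / fact n)"

text \<open>The coefficient at \<open>n = 0\<close> is \<open>- 1 / 0 = 0\<close>.\<close>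
abbreviation nlog :: "'k::field_char_0 nc \<Rightarrow> 'k nc" where
  "nlog \<equiv> pow_ser (\<lambda>n. (- 1) ^ (n + 1) / of_nat n)"

definition bch :: "'k::field_char_0 nc \<Rightarrow> 'k nc \<Rightarrow> 'k nc" where
  "bch f g = nlog (nexp f * nexp g - 1)"

lemma ser_summable_pow_ser: "ord_ge (Suc 0) h \<Longrightarrow> ser_summable (\<lambda>n. scl (a n) (h ^ n))"
  by (simp add: ser_summable_def ord_ge_scl ord_ge_power)

lemma ord_ge_pow_ser:
  assumes "a 0 = 0"
  shows "ord_ge (Suc 0) (pow_ser a h)"
  using assms by (simp add: ord_ge_Suc_0 pow_ser_def coeff_ser_sum)

lemma pow_ser_commute:
  assumes "ord_ge (Suc 0) h" "h * f = f * h"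
  shows "pow_ser a h * f = f * pow_ser a h"
  by (simp add: pow_ser_def filt_lin_ser_sum[OF filt_lin_mult_left ser_summable_pow_ser[OF assms(1)]]
      filt_lin_ser_sum[OF filt_lin_mult_right ser_summable_pow_ser[OF assms(1)]] power_commuting_commutes[OF assms(2)])

lemma pow_ser_conj:
  assumes h: "ord_ge (Suc 0) h" and uw: "u * w = 1" "w * u = 1"
  shows "pow_ser a (w * h * u) = w * pow_ser a h * u"
proof -
  have pow: "(w * h * u) ^ n = w * h ^ n * u" for n
  proof (induction n)
    case 0
    then show ?case by (simp add: uw)
  next
    case (Suc n)
    have "(w * h * u) ^ Suc n = w * h * (u * w) * h ^ n * u"
      unfolding power_Suc Suc.IH by (simp only: mult.assoc)
    then show ?case by (simp add: uw mult.assoc)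
  qed
  show ?thesis
    unfolding pow_ser_def filt_lin_ser_sum[OF filt_lin_mult_left ser_summable_pow_ser[OF h]]
    by (subst filt_lin_ser_sum[OF filt_lin_mult_right]) (simp_all add: pow ser_summable_def ord_ge_scl ord_ge_mult_left ord_ge_power[OF h])
qed

text \<open>As \<open>T h = h\<close> commutes with \<open>h\<close>, the power h^n is an
  eigenvector of eigenvalue n, and \<open>T\<close> acts on series in \<open>h\<close> as the Euler
  operator in one variable.\<close>

lemma derivation_pow_ser_eigen:
  assumes T: "derivation T" and h: "ord_ge (Suc 0) h" "T h = h"
  shows "T (pow_ser a h) = pow_ser (\<lambda>n. of_nat n * a n) h"
proof -
  have "T (h ^ n) = scl (of_nat n) (h ^ n)" for n
    using derivation_commuting_power[OF T, of h n] h(2) by (cases n) (simp_all add: power_commutes)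
  then show ?thesis
    by (simp add: pow_ser_def filt_lin_ser_sum[OF derivation_filt_lin[OF T] ser_summable_pow_ser[OF h(1)]]
        filt_lin_scl[OF derivation_filt_lin[OF T]] mult.commute)
qed

text \<open>On \<open>h\<close> the derivation agrees with the inner derivation [-, f], hence also
  on every series in \<open>h\<close>.\<close>

lemma derivation_pow_ser_lieb:
  assumes T: "derivation T" and h: "ord_ge (Suc 0) h" "T h = lieb h f"
  shows "T (pow_ser a h) = lieb (pow_ser a h) f"
proof -
  have "T (h ^ n) = lieb (h ^ n) f" for n
  proof (induction n)
    case 0
    then show ?case by (simp add: derivation_one[OF T])
  next
    case (Suc n)
    show ?case
      by (simp only: power_Suc derivation_mult[OF T] h(2) Suc.IH) (simp add: algebra_simps)
  qed
  then show ?thesis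
    by (simp add: pow_ser_def filt_lin_ser_sum[OF derivation_filt_lin[OF T] ser_summable_pow_ser[OF h(1)]]
        filt_lin_scl[OF derivation_filt_lin[OF T]] filt_lin_ser_sum[OF filt_lin_mult_left ser_summable_pow_ser[OF h(1)]]
        filt_lin_ser_sum[OF filt_lin_mult_right ser_summable_pow_ser[OF h(1)]] ser_sum_diff)
qed

lemma euler_op_nexp:
  assumes h: "ord_ge (Suc 0) h" "euler_op h = h"
  shows "euler_op (nexp h) = h * nexp h"
proof -
  let ?t = "\<lambda>n. scl (of_nat n * (1 / fact n)) (h ^ n)"
  have "euler_op (nexp h) = ser_sum ?t"
    unfolding derivation_pow_ser_eigen[OF derivation_euler_op h] by (simp add: pow_ser_def)
  also have "\<dots> = ser_sum (\<lambda>n. ?t (Suc n))"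
    by (rule ser_sum_shift) (use ord_ge_power[OF h(1), of "Suc _"] in \<open>auto simp del: power_Suc intro!: ord_ge_scl\<close>)
  also have "\<dots> = ser_sum (\<lambda>n. h * scl (1 / fact n) (h ^ n))"
    by (simp add: divide_simps del: of_nat_Suc)
  also have "\<dots> = h * nexp h"
    by (simp only: pow_ser_def filt_lin_ser_sum[OF filt_lin_mult_left ser_summable_pow_ser[OF h(1)]])
  finally show ?thesis .
qed

lemma raises_mult:
  assumes "ord_ge (Suc 0) f"
  shows "raises 1 (\<lambda>h. f * h)" "raises 1 (\<lambda>h. h * f)"
  using ord_ge_mult[OF assms] ord_ge_mult[of _ _ "Suc 0" f] assms by (auto simp: raises_def)

lemma expo_mult_left:
  assumes "ord_ge (Suc 0) f"
  shows "expo (\<lambda>h. f * h) k = nexp f * k"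
proof -
  have "((\<lambda>h. f * h) ^^ n) k = f ^ n * k" for n
    by (induction n) (simp_all add: mult.assoc)
  then show ?thesis
    by (simp add: expo_def pow_ser_def filt_lin_ser_sum[OF filt_lin_mult_right ser_summable_pow_ser[OF assms]])
qed

lemma expo_mult_right:
  assumes "ord_ge (Suc 0) f"
  shows "expo (\<lambda>h. h * f) k = k * nexp f"
proof -
  have "((\<lambda>h. h * f) ^^ n) k = k * f ^ n" for n
    by (induction n) (simp_all add: mult.assoc power_commutes)
  then show ?thesis
    by (simp add: expo_def pow_ser_def filt_lin_ser_sum[OF filt_lin_mult_left ser_summable_pow_ser[OF assms]])
qed

lemma nexp_uminus_mult:
  assumes f: "ord_ge (Suc 0) f"
  shows "nexp (- f) * nexp f = 1"
proof -
  have f': "ord_ge (Suc 0) (- f)" using f by (rule ord_ge_uminus)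
  have "expo (\<lambda>h. - f * h + f * h) 1 = expo (\<lambda>h. - f * h) (expo (\<lambda>h. f * h) 1)"
    by (rule expo_add) (simp_all only: filt_lin_mult_left raises_mult(1)[OF f] raises_mult(1)[OF f'],
        simp add: mult.assoc)
  then show ?thesis
    unfolding expo_mult_left[OF f] expo_mult_left[OF f'] by (simp add: expo_zero)
qed

lemma nexp_mult_uminus: "ord_ge (Suc 0) f \<Longrightarrow> nexp f * nexp (- f) = 1"
  using nexp_uminus_mult[OF ord_ge_uminus, of f] by simp

lemma expo_ad:
  assumes f: "ord_ge (Suc 0) f"
  shows "expo (\<lambda>h. f * h - h * f) k = nexp f * k * nexp (- f)"
proof -
  have f': "ord_ge (Suc 0) (- f)" using f by (rule ord_ge_uminus)
  have "expo (\<lambda>h. f * h + h * - f) k = expo (\<lambda>h. f * h) (expo (\<lambda>h. h * - f) k)"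
    by (rule expo_add)
      (simp_all only: filt_lin_mult_left filt_lin_mult_right raises_mult(1)[OF f] raises_mult(2)[OF f'] mult.assoc)
  then show ?thesis
    unfolding expo_mult_left[OF f] expo_mult_right[OF f'] by (simp add: mult.assoc)
qed

lemma geometric_series:
  assumes g: "ord_ge (Suc 0) g"
  shows "(1 + g) * pow_ser (\<lambda>n. (- 1) ^ n) g = 1"
proof -
  let ?t = "\<lambda>n. if n = 0 then 0 else scl ((- 1) ^ n) (g ^ n)"
  have "pow_ser (\<lambda>n. (- 1) ^ n) g = ser_sum (\<lambda>n. (if n = 0 then 1 else 0) + ?t n)"
    unfolding pow_ser_def by (rule arg_cong[where f = ser_sum]) auto
  also have "\<dots> = 1 + ser_sum ?t" by (simp only: ser_sum_add ser_sum_single)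
  also have "ser_sum ?t = ser_sum (\<lambda>n. ?t (Suc n))"
    by (rule ser_sum_shift) (use ord_ge_power[OF g, of "Suc _"] in \<open>auto simp del: power_Suc intro!: ord_ge_scl\<close>)
  also have "\<dots> = ser_sum (\<lambda>n. - (g * scl ((- 1) ^ n) (g ^ n)))"
  proof -
    have "?t (Suc n) = - (g * scl ((- 1) ^ n) (g ^ n))" for n
      by (rule nc_eqI) simp
    then show ?thesis by (simp only:)
  qed
  also have "\<dots> = - (g * pow_ser (\<lambda>n. (- 1) ^ n) g)"
    by (simp only: pow_ser_def ser_sum_uminus filt_lin_ser_sum[OF filt_lin_mult_left ser_summable_pow_ser[OF g]])
  finally show ?thesis by (simp add: algebra_simps)
qed

text \<open>The differential of log(1 + g) in the direction \<open>h\<close>, without assuming that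
  \<open>g\<close> and \<open>h\<close> commute.\<close>

definition dlog :: "'k::field_char_0 nc \<Rightarrow> 'k nc \<Rightarrow> 'k nc" where
  "dlog g h = ser_sum (\<lambda>n. scl ((- 1) ^ (n + 1) / of_nat n) (\<Sum>i<n. g ^ i * h * g ^ (n - 1 - i)))"

lemma derivation_nlog:
  assumes T: "derivation T" and g: "ord_ge (Suc 0) g"
  shows "T (nlog g) = dlog g (T g)"
proof -
  have "T (g ^ n) = (\<Sum>i<n. g ^ i * T g * g ^ (n - 1 - i))" for n
  proof (induction n)
    case 0
    then show ?case by (simp add: derivation_one[OF T])
  next
    case (Suc n)
    have "(\<Sum>i<Suc n. g ^ i * T g * g ^ (n - i)) = T g * g ^ n + (\<Sum>i<n. g ^ Suc i * T g * g ^ (n - Suc i))"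
      by (simp only: sum.lessThan_Suc_shift diff_zero power_0 mult_1_left)
    also have "(\<Sum>i<n. g ^ Suc i * T g * g ^ (n - Suc i)) = g * T (g ^ n)"
      unfolding Suc.IH sum_distrib_left by (rule sum.cong) (simp_all add: mult.assoc)
    finally show ?case by (simp add: derivation_mult[OF T])
  qed
  then show ?thesis
    by (simp add: pow_ser_def dlog_def filt_lin_ser_sum[OF derivation_filt_lin[OF T] ser_summable_pow_ser[OF g]]
        filt_lin_scl[OF derivation_filt_lin[OF T]])
qed

lemma dlog_diff: "dlog g (h - k) = dlog g h - dlog g k"
  by (simp add: dlog_def right_diff_distrib left_diff_distrib sum_subtractf ser_sum_diff)

text \<open>The term n = 1 is \<open>h\<close> itself, and every later term has a further factor
  \<open>g\<close> and therefore higher order. If the sum vanishes, the order of \<open>h\<close>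
  can be raised indefinitely.\<close>

lemma dlog_eq_0:
  assumes g: "ord_ge (Suc 0) g" and h: "ord_ge (Suc 0) h" and 0: "dlog g h = 0"
  shows "h = 0"
proof -
  have "ord_ge (Suc n) h" for n
  proof (induction n)
    case (Suc n)
    show ?case
      unfolding ord_ge_def
    proof (intro allI impI)
      fix v :: "gen list" assume v: "length v < Suc (Suc n)"
      let ?t = "\<lambda>m. scl ((- 1) ^ (m + 1) / of_nat m) (\<Sum>i<m. g ^ i * h * g ^ (m - 1 - i))"
      have "coeff (?t m) v = (if m = 1 then coeff h v else 0)" for m
      proof (cases "m \<le> 1")
        case True
        then have "m = 0 \<or> m = 1" by auto
        then show ?thesis by auto
      next
        case False
        have "ord_ge (Suc (Suc n)) (g ^ i * h * g ^ (m - 1 - i))" if "i < m" for i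
          by (rule ord_ge_le[OF ord_ge_mult[OF ord_ge_mult[OF ord_ge_power[OF g] Suc.IH] ord_ge_power[OF g]]]) (use that False in simp)
        then have "ord_ge (Suc (Suc n)) (?t m)" by (intro ord_ge_scl ord_ge_sum) simp
        then have "coeff (?t m) v = 0" using v by (rule ogD)
        then show ?thesis using False by auto
      qed
      then have "coeff (dlog g h) v = (\<Sum>m\<le>length v. if m = 1 then coeff h v else 0)"
        by (simp only: dlog_def coeff_ser_sum)
      then have "length v \<ge> 1 \<Longrightarrow> coeff h v = 0" using 0 by simp
      \<comment> \<open>At the empty word the truncated sum stops before the term n = 1, so the
        order of \<open>h\<close> has to settle this case.\<close>
      moreover have "length v = 0 \<Longrightarrow> coeff h v = 0" using h by (simp add: ord_ge_def)
      ultimately show "coeff h v = 0" by linarith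
    qed
  qed (rule h)
  then have "ord_ge n h" for n by (rule ord_ge_le[of "Suc n"]) simp
  then show ?thesis by (rule ord_ge_eq_0)
qed

text \<open>When \<open>g\<close> and \<open>h\<close> commute, the n summands coincide and cancel
  the factor 1/n. What remains is the geometric series, so the differential is multiplication by the
  inverse of 1 + g.\<close>

lemma dlog_commuting:
  assumes g: "ord_ge (Suc 0) g" and h: "ord_ge (Suc 0) h" and gh: "g * h = h * g"
  shows "dlog g h = pow_ser (\<lambda>n. (- 1) ^ n) g * h"
proof -
  let ?t = "\<lambda>n. scl ((- 1) ^ (n + 1) / of_nat n) (\<Sum>i<n. g ^ i * h * g ^ (n - 1 - i))"
  have t: "?t (Suc n) = scl ((- 1) ^ n) (g ^ n) * h" for n
  proof -
    have "g ^ i * h * g ^ (n - i) = g ^ n * h" if "i \<le> n" for i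
    proof -
      have "g ^ i * h * g ^ (n - i) = g ^ i * (g ^ (n - i) * h)"
        by (simp only: mult.assoc power_commuting_commutes[OF gh, symmetric])
      also have "\<dots> = g ^ (i + (n - i)) * h" by (simp only: mult.assoc power_add)
      finally show ?thesis using that by simp
    qed
    then have "(\<Sum>i<Suc n. g ^ i * h * g ^ (n - i)) = (\<Sum>i<Suc n. g ^ n * h)"
      by (intro sum.cong) auto
    also have "\<dots> = scl (of_nat (Suc n)) (g ^ n * h)"
      unfolding scl_of_nat by simp
    finally have *: "(\<Sum>i<Suc n. g ^ i * h * g ^ (n - i)) = scl (of_nat (Suc n)) (g ^ n * h)" .
    show ?thesis
      by (simp only: diff_Suc_1 diff_Suc_Suc diff_zero One_nat_def * scl_simps)
        (simp del: of_nat_Suc)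
  qed
  have "dlog g h = ser_sum (\<lambda>n. ?t (Suc n))"
    unfolding dlog_def
  proof (rule ser_sum_shift)
    show "ord_ge (Suc n) (?t (Suc n))" for n
      unfolding t using ord_ge_mult[OF ord_ge_scl[OF ord_ge_power[OF g]] h] by simp
  qed simp
  also have "\<dots> = pow_ser (\<lambda>n. (- 1) ^ n) g * h"
    by (simp only: t pow_ser_def filt_lin_ser_sum[OF filt_lin_mult_right ser_summable_pow_ser[OF g]])
  finally show ?thesis .
qed

text \<open>The logarithmic derivative \<open>dlog g\<close> is injective, and \<open>nlog g * (1 + g)\<close> is a preimage of
  \<open>nlog g\<close>; hence no identity between \<open>exp\<close> and \<open>log\<close> is needed.\<close>
lemma derivation_nlog_eigen_iff:
  assumes T: "derivation T" and g: "ord_ge (Suc 0) g"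
  shows "T (nlog g) = nlog g \<longleftrightarrow> T g = nlog g * (1 + g)"
proof -
  let ?h = "nlog g * (1 + g)"
  have comm: "nlog g * g = g * nlog g" by (rule pow_ser_commute[OF g refl])
  have ord_ge: "ord_ge (Suc 0) ?h" by (intro ord_ge_mult_right ord_ge_pow_ser) simp
  have "g * ?h = ?h * g" by (simp only: mult.assoc[symmetric] comm[symmetric]) (simp add: mult.assoc algebra_simps)
  then have "dlog g ?h = pow_ser (\<lambda>n. (- 1) ^ n) g * ?h"
    by (rule dlog_commuting[OF g ord_ge])
  also have "\<dots> = pow_ser (\<lambda>n. (- 1) ^ n) g * (1 + g) * nlog g"
    using comm by (simp add: distrib_left distrib_right mult.assoc)
  also have "pow_ser (\<lambda>n. (- 1) ^ n) g * (1 + g) = (1 + g) * pow_ser (\<lambda>n. (- 1) ^ n) g"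
    by (rule pow_ser_commute[OF g]) (simp add: distrib_left distrib_right)
  finally have h: "dlog g ?h = nlog g" by (simp only: geometric_series[OF g] mult_1_left)
  have Tg: "ord_ge (Suc 0) (T g - ?h)" by (intro ord_ge_diff ord_ge filt_lin_ord_ge[OF derivation_filt_lin[OF T] g])
  show ?thesis
  proof
    assume "T (nlog g) = nlog g"
    then have "dlog g (T g - ?h) = 0" by (simp only: dlog_diff h derivation_nlog[OF T g] diff_self)
    then show "T g = ?h" using dlog_eq_0[OF g Tg] by simp
  next
    assume "T g = ?h"
    then show "T (nlog g) = nlog g" by (simp only: derivation_nlog[OF T g] h)
  qed
qed

lemma ord_ge_nexp_mult: "ord_ge (Suc 0) (nexp f * nexp g - 1)"
  by (simp add: ord_ge_Suc_0 coeff_one pow_ser_def coeff_ser_sum)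

lemma ord_ge_2_bch: "ord_ge 2 (bch (gn g) (gn h) - (gn g + gn h))"
proof -
  have nlog: "ord_ge 2 (nlog f - f)" if "ord_ge (Suc 0) f" for f :: "'a nc"
    unfolding ord_ge_def
  proof (intro allI impI)
    fix v :: "gen list" assume v: "length v < 2"
    have "coeff (nlog f) v = coeff (\<Sum>n\<le>1. scl ((- 1) ^ (n + 1) / of_nat n) (f ^ n)) v"
      unfolding pow_ser_def using v by (intro coeff_ser_sum_ge ser_summable_pow_ser that) simp
    then show "coeff (nlog f - f) v = 0" by simp
  qed
  have nexp: "ord_ge 2 (nexp f - (1 + f))" if "ord_ge (Suc 0) f" for f :: "'a nc"
    unfolding ord_ge_def
  proof (intro allI impI)
    fix v :: "gen list" assume v: "length v < 2"
    have "coeff (nexp f) v = coeff (\<Sum>n\<le>1. scl (1 / fact n) (f ^ n)) v"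
      unfolding pow_ser_def using v by (intro coeff_ser_sum_ge ser_summable_pow_ser that) simp
    then show "coeff (nexp f - (1 + f)) v = 0" by simp
  qed
  let ?x = "gn g :: 'a nc" and ?y = "gn h :: 'a nc"
  have "nexp ?x * nexp ?y - 1 - (?x + ?y) = (nexp ?x - (1 + ?x)) * nexp ?y + (1 + ?x) * (nexp ?y - (1 + ?y)) + ?x * ?y"
    by (simp add: algebra_simps)
  moreover have "ord_ge 2 (?x * ?y)" using ord_ge_mult[OF ord_ge_gn ord_ge_gn, of g h] by (simp add: numeral_2_eq_2)
  ultimately have "ord_ge 2 (nexp ?x * nexp ?y - 1 - (?x + ?y))"
    by (simp add: ord_ge_add ord_ge_mult_left ord_ge_mult_right nexp ord_ge_gn)
  moreover have "ord_ge 2 (bch ?x ?y - (nexp ?x * nexp ?y - 1))"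
    unfolding bch_def by (rule nlog[OF ord_ge_nexp_mult])
  ultimately show ?thesis
    using ord_ge_add[of 2 "bch ?x ?y - (nexp ?x * nexp ?y - 1)" "nexp ?x * nexp ?y - 1 - (?x + ?y)"]
    by (simp add: algebra_simps)
qed

text \<open>exp g exp f is the conjugate of exp f exp g by exp f, and substitution into a power
  series commutes with conjugation. This is how ch(y,x) arises from ch(x,y).\<close>

lemma bch_swap:
  assumes f: "ord_ge (Suc 0) f"
  shows "bch g f = nexp (- f) * bch f g * nexp f"
proof -
  have "nexp (- f) * (nexp f * nexp g - 1) * nexp f = (nexp (- f) * nexp f) * nexp g * nexp f - nexp (- f) * nexp f"
    by (simp add: right_diff_distrib left_diff_distrib mult.assoc)
  also have "\<dots> = nexp g * nexp f - 1" by (simp only: nexp_uminus_mult[OF f] mult_1_left)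
  finally show ?thesis
    unfolding bch_def
    using pow_ser_conj[OF ord_ge_nexp_mult[of f g] nexp_mult_uminus[OF f] nexp_uminus_mult[OF f]] by simp
qed

lemma eigen_bch_iff:
  assumes C: "\<And>g. ord_ge (Suc 0) (C g)"
  shows "euler_op (bch (gn X) (gn Y)) - tder C (bch (gn X) (gn Y)) = bch (gn X) (gn Y) \<longleftrightarrow>
    gn X + gn Y - bch (gn Y) (gn X) =
      C X - nexp (- gn X) * C X * nexp (gn X) + (nexp (gn Y) * C Y * nexp (- gn Y) - C Y)"
proof -
  let ?x = "gn X :: 'a nc" and ?y = "gn Y :: 'a nc"
  let ?nexp = "nexp ?x" and ?ey = "nexp ?y" and ?ex' = "nexp (- ?x)" and ?ey' = "nexp (- ?y)" and ?b = "bch ?x ?y"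
  define T where "T f = euler_op f - tder C f" for f
  have T: "derivation T"
    unfolding T_def[abs_def] by (intro derivation_minus derivation_euler_op derivation_tder C)
  have inv: "?ex' * ?nexp = 1" "?nexp * ?ex' = 1" "?ey' * ?ey = 1" "?ey * ?ey' = 1"
    by (simp_all only: nexp_uminus_mult nexp_mult_uminus ord_ge_gn)
  have inv': "?ex' * (?nexp * f) = f" "?nexp * (?ex' * f) = f" "?ey' * (?ey * f) = f" "?ey * (?ey' * f) = f" for f
    by (simp_all only: mult.assoc[symmetric] inv mult_1_left)
  have Tex: "T (nexp (gn g)) = gn g * nexp (gn g) - lieb (nexp (gn g)) (C g)" for g
    unfolding T_def euler_op_nexp[OF ord_ge_gn euler_op_gn]
      derivation_pow_ser_lieb[OF derivation_tder[of C, OF C] ord_ge_gn tder_gn[of C, OF C]] ..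
  have rearrange: "x - c + p + (y - q + d) = r \<longleftrightarrow> x + y - r = c - p + (q - d)"
    for x y c d p q r :: "'a nc"
  proof -
    have "x - c + p + (y - q + d) - r = (x + y - r) - (c - p + (q - d))" by (simp add: algebra_simps)
    then show ?thesis by (metis eq_iff_diff_eq_0)
  qed
  have comm: "?x * ?nexp = ?nexp * ?x"
    by (rule pow_ser_commute[OF ord_ge_gn refl, symmetric])
  \<comment> \<open>The outer factors leave the logarithmic derivatives exp(-x) T(exp x) and T(exp
    y) exp(-y). One involves only \<open>C X\<close> and the other only \<open>C Y\<close>, so the
    two unknowns separate.\<close>
  have lhs: "?ex' * T (?nexp * ?ey - 1) * ?ey' = ?x - C X + ?ex' * C X * ?nexp + (?y - ?ey * C Y * ?ey' + C Y)"
    unfolding filt_lin_diff[OF derivation_filt_lin[OF T]] derivation_one[OF T] derivation_mult[OF T] Tex comm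
    by (simp only: diff_zero distrib_left distrib_right right_diff_distrib left_diff_distrib mult.assoc
        inv inv' mult_1_right) (simp add: algebra_simps)
  have rhs: "?ex' * (?b * (?nexp * ?ey)) * ?ey' = bch ?y ?x"
    by (simp only: bch_swap[OF ord_ge_gn, of ?y X] mult.assoc inv inv' mult_1_right)
  have "T ?b = ?b \<longleftrightarrow> T (?nexp * ?ey - 1) = ?b * (?nexp * ?ey)"
    unfolding bch_def using derivation_nlog_eigen_iff[OF T ord_ge_nexp_mult[of ?x ?y]] by simp
  also have "\<dots> \<longleftrightarrow> ?ex' * T (?nexp * ?ey - 1) * ?ey' = ?ex' * (?b * (?nexp * ?ey)) * ?ey'"
  proof
    assume *: "?ex' * T (?nexp * ?ey - 1) * ?ey' = ?ex' * (?b * (?nexp * ?ey)) * ?ey'"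
    have "?nexp * (?ex' * f * ?ey') * ?ey = f" for f by (simp only: mult.assoc inv inv' mult_1_right)
    then show "T (?nexp * ?ey - 1) = ?b * (?nexp * ?ey)"
      using arg_cong[OF *, of "\<lambda>f. ?nexp * f * ?ey"] by (simp only:)
  qed (simp only:)
  also have "\<dots> \<longleftrightarrow> ?x - C X + ?ex' * C X * ?nexp + (?y - ?ey * C Y * ?ey' + C Y) = bch ?y ?x"
    by (simp only: lhs rhs)
  also have "\<dots> \<longleftrightarrow> ?x + ?y - bch ?y ?x = C X - ?ex' * C X * ?nexp + (?ey * C Y * ?ey' - C Y)"
    by (rule rearrange)
  finally show ?thesis unfolding T_def .
qed

section \<open>The Kashiwara-Vergne equations\<close>

lemma spow_coeff: "spow (coeff f) n = coeff (f ^ n)"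
  by (induction n) (simp_all add: spow_def one_nc.rep_eq times_nc.rep_eq)

lemma sexp_coeff: "sexp (coeff f) = coeff (nexp f)"
  by (rule ext) (simp add: sexp_def pow_ser_def coeff_ser_sum spow_coeff)

lemma slog_coeff: "slog (coeff f) = coeff (nlog (f - 1))"
proof
  fix v
  have "slog (coeff f) v = (\<Sum>n\<in>{1..length v}. (- 1) ^ (n + 1) / of_nat n * coeff ((f - 1) ^ n) v)"
    by (simp add: slog_def Let_def flip: spow_coeff minus_nc.rep_eq one_nc.rep_eq)
  also have "\<dots> = coeff (nlog (f - 1)) v"
    unfolding pow_ser_def coeff_ser_sum coeff_scl by (rule sum.mono_neutral_left) (auto simp: not_le)
  finally show "slog (coeff f) v = coeff (nlog (f - 1)) v" .
qed

lemma ch_coeff: "ch (coeff f) (coeff g) = coeff (bch f g)"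
  by (simp add: ch_def bch_def sexp_coeff slog_coeff flip: times_nc.rep_eq)

lemma psubst_coeff: "psubst r (coeff h) = coeff (pow_ser (\<lambda>n. if n = 0 then 0 else r n) h)"
proof
  fix v
  have "psubst r (coeff h) v = (\<Sum>n\<in>{1..length v}. (if n = 0 then 0 else r n) * coeff (h ^ n) v)"
    unfolding psubst_def spow_coeff by (rule sum.cong) auto
  also have "\<dots> = coeff (pow_ser (\<lambda>n. if n = 0 then 0 else r n) h) v"
    unfolding pow_ser_def coeff_ser_sum coeff_scl by (rule sum.mono_neutral_left) (auto simp: not_le)
  finally show "psubst r (coeff h) v = coeff (pow_ser (\<lambda>n. if n = 0 then 0 else r n) h) v" .
qed

lemma opexp_coeff:
  assumes "\<And>f. T (coeff f) = coeff (T' f)"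
  shows "opexp r T (coeff f) = coeff (ser_sum (\<lambda>n. scl (r n) ((T' ^^ n) f)))"
proof -
  have "(T ^^ n) (coeff f) = coeff ((T' ^^ n) f)" for n
    by (induction n) (simp_all add: assms)
  then show ?thesis by (simp add: fun_eq_iff opexp_def coeff_ser_sum)
qed

lemma der_coeff: "der (coeff (c X)) (coeff (c Y)) (coeff f) = coeff (tder c f)"
  by (simp add: tder_def)

lemma exp_der_coeff: "exp_der (coeff (c X)) (coeff (c Y)) (coeff f) = coeff (expo (tder c) f)"
  unfolding exp_der_def expo_def by (rule opexp_coeff) (rule der_coeff)

lemma div_ser_coeff: "div_ser (coeff (c X)) (coeff (c Y)) = coeff (div_nc c)"
proof
  fix v show "div_ser (coeff (c X)) (coeff (c Y)) v = coeff (div_nc c) v"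
  proof (cases v)
    case Nil
    then show ?thesis by (simp add: div_ser_def div_nc_def coeff_mono)
  next
    case (Cons g w)
    then show ?thesis
      by (cases g) (simp_all add: div_ser_def div_nc_def UNIV_gen coeff_gn_mult(1) coeff_rpartial)
  qed
qed

lemma divergence_coeff: "divergence (coeff (c X)) (coeff (c Y)) = coeff (trace (div_nc c))"
  by (simp add: divergence_def div_ser_coeff trace_def)

lemma j_exp_coeff: "j_exp (coeff (c X)) (coeff (c Y)) = coeff (trace (j_series c))"
proof -
  have "opexp (\<lambda>n. 1 / fact (Suc n)) (der (coeff (c X)) (coeff (c Y))) (coeff (div_nc c)) = coeff (j_series c)"
    unfolding j_series_def by (rule opexp_coeff) (rule der_coeff)
  then show ?thesis by (simp only: j_exp_def div_ser_coeff trace_def coeff_Nc)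
qed

lemma opexp_brk_minus:
  assumes "ord_ge (Suc 0) f"
  shows "opexp (\<lambda>n. (- 1) ^ n / fact n) (brk (coeff f)) (coeff h) = coeff (nexp (- f) * h * nexp f)"
proof -
  have "(((\<lambda>k. - f * k - k * - f) ^^ n) h) = scl ((- 1) ^ n) (((\<lambda>k. lieb f k) ^^ n) h)" for n
  proof (induction n)
    case (Suc n)
    have "- f * scl r k - scl r k * - f = scl (- r) (lieb f k)" for r k
      by (rule nc_eqI) (simp add: algebra_simps)
    then show ?case by (simp only: funpow.simps o_apply Suc.IH power_Suc mult_minus1)
  qed simp
  then have "expo (\<lambda>k. - f * k - k * - f) h = ser_sum (\<lambda>n. scl ((- 1) ^ n / fact n) (((\<lambda>k. lieb f k) ^^ n) h))"
    by (simp add: expo_def)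
  moreover have "opexp (\<lambda>n. (- 1) ^ n / fact n) (brk (coeff f)) (coeff h)
      = coeff (ser_sum (\<lambda>n. scl ((- 1) ^ n / fact n) (((\<lambda>k. lieb f k) ^^ n) h)))"
    by (rule opexp_coeff) (simp add: fun_eq_iff brk_def ssub_def times_nc.rep_eq)
  ultimately show ?thesis
    using expo_ad[of "- f" h] ord_ge_uminus[OF assms] by simp
qed

lemma opexp_brk:
  assumes "ord_ge (Suc 0) f"
  shows "opexp (\<lambda>n. 1 / fact n) (brk (coeff f)) (coeff h) = coeff (nexp f * h * nexp (- f))"
  unfolding expo_ad[OF assms, symmetric] expo_def
  by (rule opexp_coeff) (simp add: fun_eq_iff brk_def ssub_def times_nc.rep_eq)

text \<open>Setting the other generator to 0 maps brackets to 0 in the commutative ring k[[g]], so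
  only the linear term can survive.\<close>

lemma lie_poly_replicate:
  "f \<in> lie_poly \<Longrightarrow> n \<noteq> 1 \<Longrightarrow> f (replicate n g) = 0"
proof (induction arbitrary: n rule: lie_poly.induct)
  case (bracket f h)
  have "coeff (lieb (Nc f) (Nc h)) (replicate n g) = 0"
    by (rule no_powersD[OF no_powers_lieb])
  then show ?case by (simp add: brk_def ssub_def times_nc.rep_eq)
next
  case gen_X
  then show ?case by (auto simp: smono_def dest: arg_cong[of _ _ length])
next
  case gen_Y
  then show ?case by (auto simp: smono_def dest: arg_cong[of _ _ length])
qed (simp_all add: sadd_def sscale_def)

lemma no_powers_lie_ser:
  assumes "f \<in> lie_ser" "f [g] = 0"
  shows "no_powers g (Nc f)"
proof -
  have "f (replicate n g) = 0" for n
  proof (cases "n = 1")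
    case False
    have "hom_part n f \<in> lie_poly" using assms(1) by (simp add: lie_ser_def)
    from lie_poly_replicate[OF this False, of g] show ?thesis by (simp add: hom_part_def)
  qed (use assms(2) in simp)
  then show ?thesis by (simp add: no_powers_def)
qed

text \<open>\<open>inv\<close> is defined by choice, so the cancellation needs surjectivity; the
  exponential of the negative derivation supplies preimages.\<close>

lemma inv_exp_der:
  fixes c :: "gen \<Rightarrow> 'k::field_char_0 nc"
  shows "exp_der (coeff (c X)) (coeff (c Y)) (inv (exp_der (coeff (c X)) (coeff (c Y))) f) = f"
proof -
  have raises: "raises 1 (\<lambda>f. - tder c f)"
    using raises_tder[of c] by (simp add: raises_def ord_ge_uminus)
  have "expo (\<lambda>f. tder c f + - tder c f) h = expo (tder c) (expo (\<lambda>f. - tder c f) h)" for h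
    by (rule expo_add) (simp_all add: filt_lin_tder raises_tder filt_lin_neg raises filt_lin_uminus[OF filt_lin_tder] del: One_nat_def)
  then have "expo (tder c) (expo (\<lambda>f. - tder c f) h) = h" for h
    by (simp add: expo_zero)
  then have "exp_der (coeff (c X)) (coeff (c Y)) (coeff (expo (\<lambda>f. - tder c f) (Nc h))) = h" for h
    by (simp add: exp_der_coeff)
  then have "surj (exp_der (coeff (c X)) (coeff (c Y)))"
    by (intro surjI[of "exp_der (coeff (c X)) (coeff (c Y))" "\<lambda>h. coeff (expo (\<lambda>f. - tder c f) (Nc h))"])
  then show ?thesis by (rule surj_f_inv_f)
qed

text \<open>With h = F^-1 f one has F (l h) = E (F h) = E f, so \<open>kappa\<close> is l - E, the
  negative of the tangential part of E.\<close>

lemma kappa_coeff: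
  assumes c: "\<And>g. no_powers g (c g)"
  shows "kappa (coeff (c X)) (coeff (c Y)) (coeff f) = coeff (- tder (conj_fld c) f)"
proof -
  define h where "h = Nc (inv (exp_der (coeff (c X)) (coeff (c Y))) (coeff f))"
  have "coeff (expo (tder c) h) = coeff f"
    unfolding exp_der_coeff[symmetric] by (simp add: h_def inv_exp_der)
  then have h: "expo (tder c) h = f" by (simp add: coeff_inject)
  have "kappa (coeff (c X)) (coeff (c Y)) (coeff f) = coeff (euler_op f - expo (tder c) (euler_op h))"
    by (simp add: kappa_def minus_nc.rep_eq euler_op_def h_def flip: exp_der_coeff)
  then show ?thesis
    by (simp only: conj_euler_op_expo[symmetric] h conj_euler_op_eq[of c, OF c]) (simp add: algebra_simps)
qed

text \<open>In the lowest degree n of \<open>trace f\<close> the tangential part contributes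
  nothing, as it raises degrees, and l multiplies by n. Characteristic zero and the absence of a
  constant term in a trace then force that part to vanish.\<close>

lemma trace_euler_op_minus_tder_eq_0:
  assumes C: "\<And>g. ord_ge (Suc 0) (C g)" and f: "trace (euler_op f - tder C f) = 0"
  shows "trace f = 0"
proof -
  have "ord_ge n (trace f)" for n
  proof (induction n)
    case (Suc n)
    show ?case
      unfolding ord_ge_def
    proof (intro allI impI)
      fix v :: "gen list" assume v: "length v < Suc n"
      \<comment> \<open>The order is known for \<open>trace f\<close>, not for \<open>f\<close>. The
        part of \<open>f\<close> below degree n may be nonzero, but its trace vanishes, and so does
        the trace of its image under \<open>tder C\<close>.\<close>
      have "trace (trunc n f) = 0"
      proof (rule nc_eqI)
        fix w
        have "coeff (trace (trunc n f)) w = (if length w < n then coeff (trace f) w else 0)"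
          by (auto simp: coeff_trace coeff_trunc length_rots intro!: sum.cong sum.neutral)
        then show "coeff (trace (trunc n f)) w = coeff 0 w" using Suc.IH by (simp add: ord_ge_def)
      qed
      then have "trace (tder C (trunc n f)) = 0" by (rule trace_derivation[OF derivation_tder[of C, OF C]])
      moreover have "ord_ge (Suc n) (trace (tder C (f - trunc n f)))"
        by (intro filt_lin_ord_ge[OF filt_lin_trace] raises_1D[OF raises_tder] ord_ge_diff_trunc)
      ultimately have "coeff (trace (tder C f)) v = 0"
        using v by (simp add: filt_lin_diff[OF filt_lin_tder] filt_lin_diff[OF filt_lin_trace] ord_ge_def)
      moreover have "coeff (trace (euler_op f)) v = coeff (trace (tder C f)) v"
        using f by (simp add: filt_lin_diff[OF filt_lin_trace])
      ultimately have "of_nat (length v) * coeff (trace f) v = 0"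
        by (simp add: trace_euler_op coeff_euler_op)
      moreover have "coeff (trace f) [] = 0" by (simp add: coeff_trace rots_def)
      ultimately show "coeff (trace f) v = 0" by auto
    qed
  qed simp
  then show ?thesis by (rule ord_ge_eq_0)
qed

text \<open>On the leading part the equation reads degree = 1, which order at least 2
  excludes.\<close>

lemma euler_op_minus_tder_eigen_eq_0:
  assumes f: "ord_ge 2 f" "euler_op f - tder C f = f"
  shows "f = 0"
proof -
  have "ord_ge (n + 2) f" for n
  proof (induction n)
    case (Suc n)
    show ?case
      unfolding ord_ge_def
    proof (intro allI impI)
      fix v :: "gen list" assume v: "length v < Suc n + 2"
      have "coeff (tder C f) v = 0"
        using raises_1D[OF raises_tder Suc.IH] v by (intro ogD) auto
      then have "(of_nat (length v) - 1) * coeff f v = 0"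
        using arg_cong[OF f(2), of "\<lambda>f. coeff f v"] by (simp add: coeff_euler_op algebra_simps)
      then have "coeff f v = 0 \<or> of_nat (length v) = (of_nat 1 :: 'a)" by auto
      then have "coeff f v = 0 \<or> length v = 1" by (simp only: of_nat_eq_iff)
      then show "coeff f v = 0" using f(1) by (auto simp: ord_ge_def)
    qed
  qed (use f(1) in \<open>simp add: numeral_2_eq_2\<close>)
  then have "ord_ge n f" for n by (rule ord_ge_le[of "n + 2"]) simp
  then show ?thesis by (rule ord_ge_eq_0)
qed

lemma expo_tder_minus_id: "ord_ge 1 f \<Longrightarrow> ord_ge 2 (expo (tder c) f - f)"
proof -
  assume f: "ord_ge 1 f"
  let ?t = "\<lambda>n. if n = 0 then 0 else scl (1 / fact n) ((tder c ^^ n) f)"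
  have "expo (tder c) f = ser_sum (\<lambda>n. (if n = 0 then f else 0) + ?t n)"
    unfolding expo_def by (rule arg_cong[where f = ser_sum]) auto
  also have "\<dots> = f + ser_sum ?t" by (simp only: ser_sum_add ser_sum_single)
  finally have "expo (tder c) f - f = ser_sum ?t" by simp
  moreover have "ord_ge 2 (ser_sum ?t)"
  proof (rule ord_ge_ser_sum)
    fix n
    have "ord_ge (n + 1) ((tder c ^^ n) f)" by (rule raisesD[OF raises_funpow[OF raises_tder] f])
    then show "ord_ge 2 (?t n)" by (auto intro!: ord_ge_scl elim: ord_ge_le)
  qed
  ultimately show ?thesis by simp
qed

definition delta_nc :: "(nat \<Rightarrow> 'k::field_char_0) \<Rightarrow> 'k nc" where
  "delta_nc r = pow_ser r (gn X) - pow_ser r (bch (gn X) (gn Y)) + pow_ser r (gn Y)"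

text \<open>\<open>pow_ser\<close> has a term of index 0, which \<open>psubst\<close> skips. Fixing
  r 0 = 0 picks the representative whose coefficients can later be divided by their index.\<close>

lemma delta_img_iff: "coeff (trace f) \<in> delta_img \<longleftrightarrow> (\<exists>r. r 0 = 0 \<and> trace f = trace (delta_nc r))"
proof -
  have d: "delta_ser r = coeff (delta_nc (\<lambda>n. if n = 0 then 0 else r n))" for r :: "nat \<Rightarrow> 'a"
    by (simp add: delta_ser_def delta_nc_def ch_coeff psubst_coeff plus_nc.rep_eq minus_nc.rep_eq flip: mono.rep_eq)
  have "coeff (trace f) \<in> delta_img \<longleftrightarrow> (\<exists>r. coeff (trace f) = coeff (trace (delta_nc (\<lambda>n. if n = 0 then 0 else r n))))"
    by (simp add: delta_img_def d trace_def)
  also have "\<dots> \<longleftrightarrow> (\<exists>r. r 0 = 0 \<and> trace f = trace (delta_nc r))"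
  proof
    assume "\<exists>r. r 0 = 0 \<and> trace f = trace (delta_nc r)"
    then obtain r where r: "r 0 = 0" "trace f = trace (delta_nc r)" by blast
    then have "(\<lambda>n. if n = 0 then 0 else r n) = r" by auto
    with r show "\<exists>r. coeff (trace f) = coeff (trace (delta_nc (\<lambda>n. if n = 0 then 0 else r n)))" by metis
  next
    assume "\<exists>r. coeff (trace f) = coeff (trace (delta_nc (\<lambda>n. if n = 0 then 0 else r n)))"
    then obtain r where "trace f = trace (delta_nc (\<lambda>n. if n = 0 then 0 else r n))" by (auto simp: coeff_inject)
    then show "\<exists>r. r 0 = 0 \<and> trace f = trace (delta_nc r)"
      by (intro exI[of _ "\<lambda>n. if n = 0 then 0 else r n"]) simp
  qed
  finally show ?thesis .
qed

lemma ord_ge_bch: "ord_ge (Suc 0) (bch f g)"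
  unfolding bch_def by (rule ord_ge_pow_ser) simp

text \<open>On series in a generator g the tangential part acts as the inner derivation [-, C g],
  which is invisible to the trace, so only l remains. On series in ch(x,y) the eigenvector equation
  applies.\<close>

lemma trace_euler_op_minus_tder_delta_nc:
  fixes C :: "gen \<Rightarrow> 'k::field_char_0 nc"
  defines "T \<equiv> \<lambda>f. euler_op f - tder C f"
  assumes C: "\<And>g. ord_ge (Suc 0) (C g)" and eigen: "T (bch (gn X) (gn Y)) = bch (gn X) (gn Y)"
  shows "trace (T (delta_nc r)) = trace (delta_nc (\<lambda>n. of_nat n * r n))"
proof -
  have T: "derivation T"
    unfolding T_def by (intro derivation_minus derivation_euler_op derivation_tder C)
  have gn: "trace (T (pow_ser r (gn g))) = trace (pow_ser (\<lambda>n. of_nat n * r n) (gn g))" for g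
    unfolding T_def derivation_pow_ser_eigen[OF derivation_euler_op ord_ge_gn euler_op_gn]
      derivation_pow_ser_lieb[OF derivation_tder[of C, OF C] ord_ge_gn tder_gn[of C, OF C]]
    by (simp add: filt_lin_diff[OF filt_lin_trace] trace_lieb trace_mult_commute)
  have b: "T (pow_ser r (bch (gn X) (gn Y))) = pow_ser (\<lambda>n. of_nat n * r n) (bch (gn X) (gn Y))"
    by (rule derivation_pow_ser_eigen[OF T ord_ge_bch eigen])
  show ?thesis
    by (simp add: delta_nc_def filt_lin_add[OF filt_lin_trace] filt_lin_diff[OF filt_lin_trace] filt_lin_add[OF derivation_filt_lin[OF T]]
        filt_lin_diff[OF derivation_filt_lin[OF T]] gn b)
qed

lemma delta_img_iff_eigen:
  assumes C: "\<And>g. ord_ge (Suc 0) (C g)"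
    and eigen: "euler_op (bch (gn X) (gn Y)) - tder C (bch (gn X) (gn Y)) = bch (gn X) (gn Y)"
  shows "coeff (trace f) \<in> delta_img \<longleftrightarrow> coeff (trace (euler_op f - tder C f)) \<in> delta_img"
proof -
  have T: "derivation (\<lambda>f. euler_op f - tder C f)"
    by (intro derivation_minus derivation_euler_op derivation_tder C)
  note delta_nc = trace_euler_op_minus_tder_delta_nc[of C, OF C eigen]
  show ?thesis
    unfolding delta_img_iff
  proof
    assume "\<exists>r. r 0 = 0 \<and> trace f = trace (delta_nc r)"
    then obtain r where "r 0 = 0" "trace f = trace (delta_nc r)" by blast
    then have "trace (euler_op f - tder C f) = trace (delta_nc (\<lambda>n. of_nat n * r n))"
      using trace_derivation_cong[OF T] delta_nc by metis
    then show "\<exists>r. r 0 = 0 \<and> trace (euler_op f - tder C f) = trace (delta_nc r)"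
      by (intro exI[of _ "\<lambda>n. of_nat n * r n"]) simp
  next
    assume "\<exists>r. r 0 = 0 \<and> trace (euler_op f - tder C f) = trace (delta_nc r)"
    then obtain r where r: "r 0 = 0" "trace (euler_op f - tder C f) = trace (delta_nc r)" by blast
    \<comment> \<open>Multiplication of coefficients by the index is inverted here. At index 0 the
      quotient is r 0 / 0 = 0, and r 0 = 0 makes this consistent.\<close>
    let ?q = "\<lambda>n. r n / of_nat n"
    have "(\<lambda>n. of_nat n * ?q n) = r" using r(1) by auto
    then have "trace (euler_op (delta_nc ?q) - tder C (delta_nc ?q)) = trace (euler_op f - tder C f)"
      using delta_nc[of ?q] r(2) by simp
    then have "trace (euler_op (f - delta_nc ?q) - tder C (f - delta_nc ?q)) = 0"
      by (simp add: filt_lin_diff[OF filt_lin_trace] filt_lin_diff[OF filt_lin_tder]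
          filt_lin_diff[OF derivation_filt_lin[OF derivation_euler_op]] filt_lin_add[OF filt_lin_trace] algebra_simps)
    then have "trace (f - delta_nc ?q) = 0"
      by (rule trace_euler_op_minus_tder_eq_0[of C, OF C])
    then show "\<exists>r. r 0 = 0 \<and> trace f = trace (delta_nc r)"
      by (intro exI[of _ ?q]) (simp add: filt_lin_diff[OF filt_lin_trace])
  qed
qed

theorem theorem5p10:
  fixes a b A B :: "'k::field_char_0 ser"
  assumes "is_tder a b"
    and "is_tder A B"
    and "kappa a b (smono [X]) = brk (smono [X]) A"
    and "kappa a b (smono [Y]) = brk (smono [Y]) B"
  shows "in_Sol a b \<longleftrightarrow>
    (ssub (sadd (smono [X]) (smono [Y])) (ch (smono [Y]) (smono [X])) =
       sadd (ssub A (opexp (\<lambda>n. (-1) ^ n / fact n) (brk (smono [X])) A))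
            (ssub (opexp (\<lambda>n. 1 / fact n) (brk (smono [Y])) B) B)
     \<and> divergence A B \<in> delta_img)"
proof -
  define c C where "c = case_gen (Nc a) (Nc b)" and "C = case_gen (Nc A) (Nc B)"
  have coeffs: "a = coeff (c X)" "b = coeff (c Y)" "A = coeff (C X)" "B = coeff (C Y)"
    and smono: "smono w = coeff (mono w)" for w
    by (simp_all add: c_def C_def mono.rep_eq)
  have c: "no_powers g (c g)" and C: "no_powers g (C g)" for g
    using assms(1,2) by (cases g; simp add: c_def C_def is_tder_def no_powers_lie_ser)+
  note c1 = no_powers_ord_ge_all[of c, OF c] and C1 = no_powers_ord_ge_all[of C, OF C]
  let ?P = "conj_fld c" and ?x = "gn X :: 'k nc" and ?y = "gn Y :: 'k nc"
  let ?b = "bch ?x ?y"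
  note P = no_powers_conj_fld[of c, OF c]
  note P1 = no_powers_ord_ge_all[of ?P, OF P]
  \<comment> \<open>\<open>conj_fld\<close> describes E - l whereas \<open>kappa\<close> is l - E,
    hence the sign. Both components are free of powers of g, so they are recovered from their
    brackets with g.\<close>
  have P_eq: "?P g = - C g" for g
  proof -
    have "coeff (- tder ?P (gn g)) = coeff (lieb (gn g) (C g))"
      unfolding kappa_coeff[of c, OF c, symmetric]
      using assms(3,4) by (cases g) (simp_all add: coeffs smono brk_def minus_nc.rep_eq times_nc.rep_eq)
    then have "lieb (gn g) (?P g + C g) = 0"
      by (simp add: coeff_inject tder_gn[of ?P, OF P1] algebra_simps)
    then have "?P g + C g = 0"
      by (rule lieb_gn_eq_0) (rule no_powersD[OF no_powers_add[OF P C]])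
    then show ?thesis by (rule eq_neg_iff_add_eq_0[THEN iffD2])
  qed
  have "tder ?P f = - tder C f" for f
    by (rule derivation_eqI[where f = f, OF derivation_tder[of ?P, OF P1]
          derivation_neg[OF derivation_tder[of C, OF C1]]])
      (simp add: tder_gn[of ?P, OF P1] tder_gn[of C, OF C1] P_eq)
  then have conj_euler_op: "conj_euler_op c f = euler_op f - tder C f" for f
    by (simp add: conj_euler_op_eq[of c, OF c])
  have "div_nc ?P = - div_nc C"
    by (simp add: div_nc_def P_eq[abs_def] filt_lin_uminus[OF filt_lin_gn_rpartial] sum_negf)
  then have div: "trace (div_nc C) = trace (euler_op (j_series c) - tder C (j_series c))"
    using trace_div_nc_conj_fld[of c, OF c1] by (simp add: conj_euler_op filt_lin_uminus[OF filt_lin_trace])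

  have eigen: "expo (tder c) (?x + ?y) = ?b \<longleftrightarrow> euler_op ?b - tder C ?b = ?b"
  proof
    assume "expo (tder c) (?x + ?y) = ?b"
    then show "euler_op ?b - tder C ?b = ?b"
      using conj_euler_op_expo[of c "?x + ?y"]
      by (simp add: conj_euler_op filt_lin_add[OF derivation_filt_lin[OF derivation_euler_op]] euler_op_gn)
  next
    assume eigen: "euler_op ?b - tder C ?b = ?b"
    let ?w = "?b - expo (tder c) (?x + ?y)"
    have "euler_op ?w - tder C ?w = ?w"
      using conj_euler_op_expo[of c "?x + ?y"] eigen
      by (simp add: conj_euler_op filt_lin_add[OF derivation_filt_lin[OF derivation_euler_op]] euler_op_gn
          filt_lin_diff[OF derivation_filt_lin[OF derivation_euler_op]] filt_lin_diff[OF filt_lin_tder] algebra_simps)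
    moreover have "ord_ge 2 ?w"
    proof -
      have "ord_ge 1 (?x + ?y)" using ord_ge_add[OF ord_ge_gn ord_ge_gn] by simp
      then have "ord_ge 2 (?b - (?x + ?y) - (expo (tder c) (?x + ?y) - (?x + ?y)))"
        by (intro ord_ge_diff ord_ge_2_bch expo_tder_minus_id)
      moreover have "?b - (?x + ?y) - (expo (tder c) (?x + ?y) - (?x + ?y)) = ?w" by (simp only: diff_diff_eq2 diff_add_cancel)
      ultimately show ?thesis by (simp only:)
    qed
    ultimately show "expo (tder c) (?x + ?y) = ?b"
      using euler_op_minus_tder_eigen_eq_0[of ?w C] by simp
  qed
  then have kv1: "expo (tder c) (?x + ?y) = ?b \<longleftrightarrow> ?x + ?y - bch ?y ?x =
      C X - nexp (- ?x) * C X * nexp ?x + (nexp ?y * C Y * nexp (- ?y) - C Y)"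
    by (simp only: eigen_bch_iff[of C, OF C1])
  \<comment> \<open>The two divergence conditions are compared under the first equation, since it
    makes ch(x,y) an eigenvector of E.\<close>
  have kv2: "coeff (trace (j_series c)) \<in> delta_img \<longleftrightarrow> coeff (trace (div_nc C)) \<in> delta_img"
    if "expo (tder c) (?x + ?y) = ?b"
    unfolding div by (rule delta_img_iff_eigen[of C, OF C1]) (use that eigen in blast)
  have sol: "in_Sol a b \<longleftrightarrow> expo (tder c) (?x + ?y) = ?b \<and> coeff (trace (j_series c)) \<in> delta_img"
    by (simp add: in_Sol_def coeffs(1,2) smono exp_der_coeff ch_coeff j_exp_coeff coeff_inject
        flip: plus_nc.rep_eq)
  have kv_eq: "ssub (sadd (smono [X]) (smono [Y])) (ch (smono [Y]) (smono [X])) =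
       sadd (ssub A (opexp (\<lambda>n. (-1) ^ n / fact n) (brk (smono [X])) A))
            (ssub (opexp (\<lambda>n. 1 / fact n) (brk (smono [Y])) B) B)
    \<longleftrightarrow> ?x + ?y - bch ?y ?x = C X - nexp (- ?x) * C X * nexp ?x + (nexp ?y * C Y * nexp (- ?y) - C Y)"
    by (simp add: coeffs(3,4) smono ch_coeff opexp_brk opexp_brk_minus ord_ge_gn coeff_inject
        flip: plus_nc.rep_eq minus_nc.rep_eq)
  have div_eq: "divergence A B = coeff (trace (div_nc C))"
    by (simp add: coeffs(3,4) divergence_coeff)
  show ?thesis
    unfolding sol kv_eq div_eq kv1[symmetric] using kv2 by blast
qed

end
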